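(* Let $D\ge2$ and let $\mathcal{M}_p$ be an edge-colored map with $p$ cilia whose boundary graph $\mathcal{B}=\partial\mathcal{M}_p$ is a bubble (with $p$ white vertices), and let $\Omega$ be the pairing of $\mathcal{B}$ induced by $\mathcal{M}_p$. Then $$\delta(\mathcal{M}_p)\le-(D-1)\bigl(p+\mathrm{opt}_{\mathcal{B}}(\Omega)-1\bigr).$$ Moreover, equality holds if and only if all of the following hold: (1) $\mathcal{M}_p^{(i)}$ is a forest for each $i\in[D]$; (2) denoting by $\mathcal{T}^{(i)}_{ext}$ the subforest of $\mathcal{M}_p^{(i)}$ formed by its trees (connected components) containing at least two ciliated vertices, trees of $\mathcal{T}^{(i)}_{ext}$ and $\mathcal{T}^{(j)}_{ext}$ for distinct colors can share only ciliated vertices; (3) the subgraph of $\mathcal{M}_p$ formed by the edges not in $\bigcup_{i\in[D]}\mathcal{T}^{(i)}_{ext}$ is a forest, each of whose trees meets $\bigcup_{i\in[D]}\mathcal{T}^{(i)}_{ext}$ at a single vertex.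
   Context: Write $[D]=\{1,\dots,D\}$. A bubble is a finite connected bipartite graph with edges colored in $[D]$, each vertex incident to exactly one edge of each color. An edge-colored map is a connected combinatorial map whose edges carry colors in $[D]$ (coloring not necessarily proper); a cilium is a marker in a corner of a vertex, at most one per vertex, splitting the corner in two. For $i\in[D]$, $\mathcal{M}^{(i)}$ keeps all vertices and cilia but only edges of color $i$. Going around the boundary of $\mathcal{M}^{(i)}$ (turning clockwise around vertices) gives cyclic sequences; those with no cilium are the closed faces of color $i$ (an isolated unciliated vertex counts as one), those containing cilia are cut at each cilium into broken faces (oriented walks from one cilium to the next, possibly the same; trivial if traversing no edge). The power is $\delta(\mathcal{M})=\mathcal{F}(\mathcal{M})-(D-1)\mathcal{E}(\mathcal{M})$, with $\mathcal{F}$ the total number of closed faces over all colors and $\mathcal{E}$ the number of edges. Boundary graph $\partial\mathcal{M}$: for each ciliated vertex $V$ create a white vertex $v$ and black vertex $\bar v$; for each non-trivial broken face of color $i$ from the cilium at $V$ to the cilium at $V'$ add an edge of color $i$ between $v$ and $\bar v'$; then for each $V$ and color $i$ not yet incident to $v$ add an edge of color $i$ between $v$ and $\bar v$. The induced pairing $\Omega$ consists of the pairs $\{v,\bar v\}$. $\mathcal{B}_{\circlearrowleft,\Omega}$ is the directed multigraph obtained from $\mathcal{B}$ by orienting edges from white to black, contracting each pair of $\Omega$ to a vertex and deleting edges joining the two vertices of a pair; $\mathcal{B}^{(i)}_{\circlearrowleft,\Omega}$ keeps all vertices and the edges of color $i$. Circuit rank of a multigraph with $\mathcal{V}$ vertices,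 $\mathcal{E}$ edges, $k$ components: $l=\mathcal{E}-\mathcal{V}+k$. Optimality: $\mathrm{opt}_{\mathcal{B}}(\Omega)=l(\mathcal{B}_{\circlearrowleft,\Omega})-\sum_{i=1}^D l(\mathcal{B}^{(i)}_{\circlearrowleft,\Omega})$.
   Formalization: "Equality implies (1)-(3)" is stated only for D≥3 (it fails for D=2: one ciliated vertex with a loop); the bound and the converse hold for D≥2. In (3), the single-vertex requirement is imposed only if the union of the T_ext is nonempty (it fails for p=1). *)

theory Defs
  imports "Graph_Theory.Graph_Theory"
begin

section \<open>Undirected multigraphs\<close>

text \<open>
  An undirected multigraph is a \<^typ>\<open>('a,'b) pre_digraph\<close> whose arcs carry an irrelevant reference
  orientation. The notions below, like \<^const>\<open>connected\<close>, do not depend on it. The constant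
  \<^const>\<open>forest\<close> of the library only excludes directed cycles and is not used.
\<close>

definition components :: "('a, 'b) pre_digraph \<Rightarrow> 'a set set" where
  "components G = pre_digraph.sccs_verts (with_proj (mk_symmetric G))"

definition circuit_rank :: "('a, 'b) pre_digraph \<Rightarrow> int" where
  "circuit_rank G = int (card (arcs G)) - int (card (verts G)) + int (card (components G))"

definition both_directions :: "('a, 'b) pre_digraph \<Rightarrow> ('a, 'b \<times> bool) pre_digraph" where
  "both_directions G = \<lparr> verts = verts G, arcs = arcs G \<times> UNIV,
     tail = (\<lambda>(e, b). if b then head G e else tail G e),
     head = (\<lambda>(e, b). if b then tail G e else head G e) \<rparr>"

text \<open>The distinctness condition excludes walking back along the edge just used.\<close>

definition undirected_forest :: "('a, 'b) pre_digraph \<Rightarrow> bool" where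
  "undirected_forest G \<longleftrightarrow>
     \<not> (\<exists>p. pre_digraph.cycle (both_directions G) p \<and> distinct (map fst p))"

record ('a, 'b) colored_graph =
  mgraph :: "('a, 'b) pre_digraph"
  color :: "'b \<Rightarrow> nat"

definition color_part :: "('a, 'b, 'z) colored_graph_scheme \<Rightarrow> nat \<Rightarrow> ('a, 'b) pre_digraph" where
  "color_part G i = (mgraph G) \<lparr> arcs := {e \<in> arcs (mgraph G). color G e = i} \<rparr>"


section \<open>Bubbles, pairings and optimality\<close>

text \<open>Here the reference orientation is from white to black.\<close>

record ('a, 'b) bipartite_graph = "('a, 'b) colored_graph" +
  white :: "'a set"

definition bubble :: "nat \<Rightarrow> ('a, 'b) bipartite_graph \<Rightarrow> bool" where
  "bubble D B \<longleftrightarrow>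
     fin_digraph (mgraph B) \<and> connected (mgraph B) \<and>
     white B \<subseteq> verts (mgraph B) \<and>
     (\<forall>e \<in> arcs (mgraph B). tail (mgraph B) e \<in> white B \<and> head (mgraph B) e \<notin> white B) \<and>
     (\<forall>e \<in> arcs (mgraph B). color B e \<in> {1..D}) \<and>
     (\<forall>x \<in> verts (mgraph B). \<forall>i \<in> {1..D}.
        \<exists>!e. e \<in> arcs (mgraph B) \<and> color B e = i \<and> (tail (mgraph B) e = x \<or> head (mgraph B) e = x))"

definition pair_of :: "'a set set \<Rightarrow> 'a \<Rightarrow> 'a set" where
  "pair_of \<Omega> x = (THE P. P \<in> \<Omega> \<and> x \<in> P)"

definition contract :: "('a, 'b) bipartite_graph \<Rightarrow> 'a set set \<Rightarrow> ('a set, 'b) colored_graph" where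
  "contract B \<Omega> = \<lparr>
     mgraph = \<lparr> verts = \<Omega>,
       arcs = {e \<in> arcs (mgraph B). \<not> (\<exists>P \<in> \<Omega>. tail (mgraph B) e \<in> P \<and> head (mgraph B) e \<in> P)},
       tail = (\<lambda>e. pair_of \<Omega> (tail (mgraph B) e)),
       head = (\<lambda>e. pair_of \<Omega> (head (mgraph B) e)) \<rparr>,
     color = color B \<rparr>"

definition optimality :: "nat \<Rightarrow> ('a, 'b) bipartite_graph \<Rightarrow> 'a set set \<Rightarrow> int" where
  "optimality D B \<Omega> =
     circuit_rank (mgraph (contract B \<Omega>)) - (\<Sum>i = 1..D. circuit_rank (color_part (contract B \<Omega>) i))"


section \<open>Edge-colored maps with cilia\<close>

text \<open>
  A cilium is a dart of its own in the rotation around its vertex, placed in the corner it splits.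
  It is named after its vertex, so that a vertex has at most one. The edge \<open>e\<close> has the two darts
  \<open>Half e False\<close> at its tail and \<open>Half e True\<close> at its head. The field \<open>rot\<close> sends a dart to the next
  one clockwise around the same vertex; its values off the darts of the map are irrelevant.
\<close>

datatype ('v, 'e) dart = Half 'e bool | Cilium 'v

record ('v, 'e) colored_map = "('v, 'e) colored_graph" +
  cilia :: "'v set"
  rot :: "('v, 'e) dart \<Rightarrow> ('v, 'e) dart"

definition darts :: "('v, 'e) colored_map \<Rightarrow> ('v, 'e) dart set" where
  "darts M = {Half e b | e b. e \<in> arcs (mgraph M)} \<union> Cilium ` cilia M"

fun dart_vertex :: "('v, 'e) colored_map \<Rightarrow> ('v, 'e) dart \<Rightarrow> 'v" where
  "dart_vertex M (Half e b) = (if b then head (mgraph M) e else tail (mgraph M) e)"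
| "dart_vertex M (Cilium v) = v"

definition darts_at :: "('v, 'e) colored_map \<Rightarrow> 'v \<Rightarrow> ('v, 'e) dart set" where
  "darts_at M v = {d \<in> darts M. dart_vertex M d = v}"

definition edge_colored_map :: "nat \<Rightarrow> ('v, 'e) colored_map \<Rightarrow> bool" where
  "edge_colored_map D M \<longleftrightarrow>
     fin_digraph (mgraph M) \<and> connected (mgraph M) \<and>
     (\<forall>e \<in> arcs (mgraph M). color M e \<in> {1..D}) \<and>
     cilia M \<subseteq> verts (mgraph M) \<and>
     (\<forall>v \<in> verts (mgraph M). darts_at M v \<noteq> {} \<longrightarrow> cyclic_on (rot M) (darts_at M v))"

definition first_return :: "('d \<Rightarrow> 'd) \<Rightarrow> 'd set \<Rightarrow> 'd \<Rightarrow> 'd" where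
  "first_return f S x = (f ^^ (LEAST n. 0 < n \<and> (f ^^ n) x \<in> S)) x"

definition color_submap :: "('v, 'e) colored_map \<Rightarrow> nat \<Rightarrow> ('v, 'e) colored_map" where
  "color_submap M i =
     (let N = M \<lparr> mgraph := color_part M i \<rparr>
      in N \<lparr> rot := first_return (rot M) (darts N) \<rparr>)"

fun opposite :: "('v, 'e) dart \<Rightarrow> ('v, 'e) dart" where
  "opposite (Half e b) = Half e (\<not> b)"
| "opposite (Cilium v) = Cilium v"

text \<open>
  Boundary step: cross the edge of the current dart, or stay in place if the dart is a cilium, and
  turn clockwise to the next dart.
\<close>

definition boundary_step :: "('v, 'e) colored_map \<Rightarrow> ('v, 'e) dart \<Rightarrow> ('v, 'e) dart" where
  "boundary_step N d = rot N (opposite d)"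

definition num_closed_faces :: "('v, 'e) colored_map \<Rightarrow> nat \<Rightarrow> nat" where
  "num_closed_faces M i =
     (let N = color_submap M i in
        card {orbit (boundary_step N) d | d.
                d \<in> darts N \<and> orbit (boundary_step N) d \<inter> range Cilium = {}}
        + card {v \<in> verts (mgraph N). darts_at N v = {}})"

definition map_power :: "nat \<Rightarrow> ('v, 'e) colored_map \<Rightarrow> int" where
  "map_power D M =
     int (\<Sum>i = 1..D. num_closed_faces M i) - (int D - 1) * int (card (arcs (mgraph M)))"

text \<open>\<open>broken_face M i n v w\<close>: a broken face of color \<open>i\<close> from \<open>v\<close> to \<open>w\<close> traverses \<open>n\<close> edges.\<close>

definition broken_face :: "('v, 'e) colored_map \<Rightarrow> nat \<Rightarrow> nat \<Rightarrow> 'v \<Rightarrow> 'v \<Rightarrow> bool" where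
  "broken_face M i n v w \<longleftrightarrow>
     (let f = boundary_step (color_submap M i) in
        v \<in> cilia M \<and> w \<in> cilia M \<and>
        (\<forall>k \<in> {1..n}. (f ^^ k) (Cilium v) \<notin> range Cilium) \<and>
        (f ^^ Suc n) (Cilium v) = Cilium w)"

definition nontrivial_broken_face :: "('v, 'e) colored_map \<Rightarrow> nat \<Rightarrow> 'v \<Rightarrow> 'v \<Rightarrow> bool" where
  "nontrivial_broken_face M i v w \<longleftrightarrow> (\<exists>n > 0. broken_face M i n v w)"


section \<open>Boundary graph\<close>

datatype 'v boundary_vertex = White 'v | Black 'v

text \<open>
  The edge \<open>(i, v, w)\<close> has color \<open>i\<close> and joins \<open>White v\<close> to \<open>Black w\<close>. Triples suffice, since exactly
  one broken face of each color starts at a given cilium.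
\<close>

definition boundary_graph ::
  "nat \<Rightarrow> ('v, 'e) colored_map \<Rightarrow> ('v boundary_vertex, nat \<times> 'v \<times> 'v) bipartite_graph" where
  "boundary_graph D M = \<lparr>
     mgraph = \<lparr> verts = White ` cilia M \<union> Black ` cilia M,
       arcs = {(i, v, w) | i v w. i \<in> {1..D} \<and> nontrivial_broken_face M i v w}
            \<union> {(i, v, v) | i v. i \<in> {1..D} \<and> v \<in> cilia M \<and> \<not> (\<exists>w. nontrivial_broken_face M i v w)},
       tail = (\<lambda>(i, v, w). White v),
       head = (\<lambda>(i, v, w). Black w) \<rparr>,
     color = (\<lambda>(i, v, w). i),
     white = White ` cilia M \<rparr>"

definition induced_pairing :: "('v, 'e) colored_map \<Rightarrow> 'v boundary_vertex set set" where
  "induced_pairing M = {{White v, Black v} | v. v \<in> cilia M}"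


section \<open>External forests\<close>

definition ext_forest :: "('v, 'e) colored_map \<Rightarrow> nat \<Rightarrow> ('v, 'e) pre_digraph" where
  "ext_forest M i =
     color_part M i \<restriction> \<Union> {C \<in> components (color_part M i). 2 \<le> card (C \<inter> cilia M)}"

definition ext_verts :: "nat \<Rightarrow> ('v, 'e) colored_map \<Rightarrow> 'v set" where
  "ext_verts D M = (\<Union>i \<in> {1..D}. verts (ext_forest M i))"

definition non_ext_graph :: "nat \<Rightarrow> ('v, 'e) colored_map \<Rightarrow> ('v, 'e) pre_digraph" where
  "non_ext_graph D M =
     (let A = arcs (mgraph M) - (\<Union>i \<in> {1..D}. arcs (ext_forest M i)) in
      (mgraph M) \<lparr> verts := tail (mgraph M) ` A \<union> head (mgraph M) ` A, arcs := A \<rparr>)"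

definition monochromatic_forests :: "nat \<Rightarrow> ('v, 'e) colored_map \<Rightarrow> bool" where
  "monochromatic_forests D M \<longleftrightarrow> (\<forall>i \<in> {1..D}. undirected_forest (color_part M i))"

definition ext_forests_share_cilia :: "nat \<Rightarrow> ('v, 'e) colored_map \<Rightarrow> bool" where
  "ext_forests_share_cilia D M \<longleftrightarrow>
     (\<forall>i \<in> {1..D}. \<forall>j \<in> {1..D}. i \<noteq> j \<longrightarrow>
        verts (ext_forest M i) \<inter> verts (ext_forest M j) \<subseteq> cilia M)"

text \<open>
  With a single cilium there is no external tree at all, and the requirement on the number of common
  vertices is void.
\<close>

definition non_ext_forest :: "nat \<Rightarrow> ('v, 'e) colored_map \<Rightarrow> bool" where
  "non_ext_forest D M \<longleftrightarrow>
     undirected_forest (non_ext_graph D M) \<and>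
     (ext_verts D M \<noteq> {} \<longrightarrow>
        (\<forall>C \<in> components (non_ext_graph D M). card (C \<inter> ext_verts D M) = 1))"

end

theory Submission
  imports Defs
begin

text \<open>
  For a color \<open>i\<close> let \<open>k i\<close> and \<open>l i\<close> be the number of components and the circuit rank of its
  submap, \<open>c i\<close> the number of components with a cilium, \<open>F i\<close> the number of closed faces and \<open>b i\<close> the
  number of cycles of the permutation of the cilia given by the broken faces. Since the boundary graph
  is connected, the optimality is \<open>(D - 1) p + 1 - (\<Sum>i. b i)\<close>, and the bound minus the power equals
  \<open>D X + D (\<Sum>i. b i - c i) + (D - 2) (\<Sum>i. l i) + (\<Sum>i. k i + l i - F i - b i)\<close>, where
  \<open>X = (D - 1) (V - p) - (\<Sum>i. k i - c i)\<close>. All four terms are nonnegative: the last one is the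
  nonnegativity of the genus. If every \<open>l i\<close> vanishes, a component has exactly one face, so only \<open>D X\<close>
  survives; conversely, for \<open>D \<ge> 3\<close> equality forces every \<open>l i\<close> and \<open>X\<close> to vanish.

  For monochromatic forests, counting edges in the external trees turns \<open>X\<close> into the number of
  non-external edges, plus the number of non-ciliated vertices of the external forests counted with
  multiplicity, minus the number of all non-ciliated vertices, and this vanishes exactly under
  conditions (2) and (3). In general \<open>X\<close> depends only on the components of the color parts, so
  monochromatic cycles can be cut open without changing it.
\<close>

section \<open>Components and circuit rank\<close>

definition eqcl :: "'a rel \<Rightarrow> 'a rel" where
  "eqcl r = (r \<union> r\<inverse>)\<^sup>*"

text \<open>Classes are formed in the whole type: points untouched by \<open>r\<close> are
  singletons, and a class stays inside \<open>V\<close> only when \<open>r\<close> is a relation on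
  \<open>V\<close>.\<close>

definition classes :: "'a set \<Rightarrow> 'a rel \<Rightarrow> 'a set set" where
  "classes V r = (\<lambda>v. eqcl r `` {v}) ` V"

lemma eqcl_refl [simp, intro!]: "(x, x) \<in> eqcl r"
  by (simp add: eqcl_def)

lemma eqcl_sym: "(x, y) \<in> eqcl r \<Longrightarrow> (y, x) \<in> eqcl r"
  unfolding eqcl_def by (rule symD[OF sym_rtrancl[OF sym_Un_converse]])

lemma eqcl_sym_iff: "(x, y) \<in> eqcl r \<longleftrightarrow> (y, x) \<in> eqcl r"
  using eqcl_sym by metis

lemma eqcl_trans: "(x, y) \<in> eqcl r \<Longrightarrow> (y, z) \<in> eqcl r \<Longrightarrow> (x, z) \<in> eqcl r"
  by (simp add: eqcl_def)

lemma eqcl_base: "(x, y) \<in> r \<Longrightarrow> (x, y) \<in> eqcl r"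
  by (auto simp: eqcl_def)

text \<open>Induction along a chain. The map \<open>h\<close> allows a change of carrier, as when
  the boundary graph is projected to the cilia.\<close>

lemma eqcl_least:
  assumes "(x, y) \<in> eqcl r" "\<And>x y. (x, y) \<in> r \<Longrightarrow> (h x, h y) \<in> eqcl s"
  shows "(h x, h y) \<in> eqcl s"
  using assms(1) unfolding eqcl_def
proof (induction rule: rtrancl_induct)
  case (step y z)
  from step.hyps(2) have "(h y, h z) \<in> eqcl s" using assms(2) eqcl_sym[OF assms(2)] by auto
  then show ?case using eqcl_trans[of "h x" "h y" s "h z"] step.IH by (simp add: eqcl_def)
qed (simp)

lemma eqcl_mono: "r \<subseteq> s \<Longrightarrow> (x, y) \<in> eqcl r \<Longrightarrow> (x, y) \<in> eqcl s"
  using eqcl_least[of x y r "\<lambda>x. x" s] eqcl_base[of _ _ s] by auto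

text \<open>A set that no pair of \<open>r\<close> enters or leaves is a union of classes; this is
  the tool for showing that points are not connected.\<close>

lemma eqcl_closed:
  assumes "(x, y) \<in> eqcl r" "x \<in> S" "\<And>x y. (x, y) \<in> r \<Longrightarrow> x \<in> S \<longleftrightarrow> y \<in> S"
  shows "y \<in> S"
  using assms(1) unfolding eqcl_def
proof (induction rule: rtrancl_induct)
  case (step y z)
  then show ?case using assms(3)[of y z] assms(3)[of z y] by blast
qed (rule assms(2))

lemma eqcl_class_eq_iff: "eqcl r `` {x} = eqcl r `` {y} \<longleftrightarrow> (x, y) \<in> eqcl r"
proof
  assume "eqcl r `` {x} = eqcl r `` {y}"
  then have "y \<in> eqcl r `` {x}" by simp
  then show "(x, y) \<in> eqcl r" by simp
next
  assume xy: "(x, y) \<in> eqcl r"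
  show "eqcl r `` {x} = eqcl r `` {y}"
    using eqcl_trans[OF xy] eqcl_trans[OF eqcl_sym[OF xy]] by auto
qed

lemma eqcl_class_eq: "(x, y) \<in> eqcl r \<Longrightarrow> eqcl r `` {x} = eqcl r `` {y}"
  by (simp add: eqcl_class_eq_iff)

text \<open>A chain needs the new pair at most once: after a second passage it is back at an
  endpoint it could have reached without that pair.\<close>

lemma eqcl_insert_cases:
  assumes "(x, y) \<in> eqcl (insert (a, b) r)"
  shows "(x, y) \<in> eqcl r \<or> (x, a) \<in> eqcl r \<and> (b, y) \<in> eqcl r \<or> (x, b) \<in> eqcl r \<and> (a, y) \<in> eqcl r"
  using assms unfolding eqcl_def[of "insert _ _"]
proof (induction rule: rtrancl_induct)
  case base
  show ?case by simp
next
  case (step y z)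
  from step.hyps(2) consider "(y, z) \<in> eqcl r" | "y = a" "z = b" | "y = b" "z = a"
    by (auto intro: eqcl_base eqcl_sym)
  then show ?case
  proof cases
    case 1
    then show ?thesis using step.IH eqcl_trans[OF _ 1] by blast
  next
    case 2
    then show ?thesis using step.IH eqcl_trans[OF _ eqcl_sym, of x a r] by blast
  next
    case 3
    then show ?thesis using step.IH eqcl_trans[OF _ eqcl_sym, of x b r] by blast
  qed
qed

lemma eqcl_insert_iff:
  "(x, y) \<in> eqcl (insert (a, b) r) \<longleftrightarrow>
     (x, y) \<in> eqcl r \<or> (x, a) \<in> eqcl r \<and> (b, y) \<in> eqcl r \<or> (x, b) \<in> eqcl r \<and> (a, y) \<in> eqcl r"
proof -
  have ab: "(a, b) \<in> eqcl (insert (a, b) r)" by (simp add: eqcl_base)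
  have sub: "(u, v) \<in> eqcl r \<Longrightarrow> (u, v) \<in> eqcl (insert (a, b) r)" for u v
    by (rule eqcl_mono) auto
  show ?thesis (is "_ \<longleftrightarrow> ?R")
  proof
    assume ?R
    then show "(x, y) \<in> eqcl (insert (a, b) r)"
      using sub eqcl_trans[OF sub eqcl_trans[OF ab sub], of x y]
        eqcl_trans[OF sub eqcl_trans[OF eqcl_sym[OF ab] sub], of x y] by metis
  qed (rule eqcl_insert_cases)
qed

lemma eqcl_insert_redundant:
  assumes "(a, b) \<in> eqcl r"
  shows "eqcl (insert (a, b) r) = eqcl r"
proof -
  have "(x, y) \<in> eqcl r" if "(x, y) \<in> eqcl (insert (a, b) r)" for x y
    using eqcl_insert_cases[OF that] eqcl_trans[OF eqcl_trans[OF _ assms]]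
      eqcl_trans[OF eqcl_trans[OF _ eqcl_sym[OF assms]]] by blast
  moreover have "(x, y) \<in> eqcl (insert (a, b) r)" if "(x, y) \<in> eqcl r" for x y
    using that by (rule eqcl_mono[rotated]) auto
  ultimately show ?thesis by auto
qed

lemma finite_classes [simp]: "finite V \<Longrightarrow> finite (classes V r)"
  by (simp add: classes_def)

lemma classes_closed:
  assumes "K \<in> classes V r" "r \<subseteq> V \<times> V"
  shows "K \<subseteq> V"
proof
  fix y assume "y \<in> K"
  then obtain x where "x \<in> V" "(x, y) \<in> eqcl r" using assms(1) by (auto simp: classes_def)
  then show "y \<in> V" by (elim eqcl_closed) (use assms(2) in auto)
qed

lemma classes_Union:
  assumes "r \<subseteq> V \<times> V"
  shows "\<Union> (classes V r) = V"
proof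
  show "\<Union> (classes V r) \<subseteq> V" using classes_closed[OF _ assms] by blast
  show "V \<subseteq> \<Union> (classes V r)" by (auto simp: classes_def)
qed

lemma classes_nonempty: "K \<in> classes V r \<Longrightarrow> K \<noteq> {}"
  unfolding classes_def by blast

lemma classes_memberD:
  assumes "K \<in> classes V r" "x \<in> K"
  shows "K = eqcl r `` {x}"
proof -
  obtain v where v: "K = eqcl r `` {v}" using assms(1) by (auto simp: classes_def)
  with assms(2) have "(v, x) \<in> eqcl r" by simp
  with v show ?thesis by (simp add: eqcl_class_eq)
qed

lemma classes_disjoint: "K \<in> classes V r \<Longrightarrow> L \<in> classes W r \<Longrightarrow> K \<noteq> L \<Longrightarrow> K \<inter> L = {}"
  using classes_memberD[of K V r] classes_memberD[of L W r] by blast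

lemma card_classes_eq_1:
  assumes "c \<in> V" "\<And>v. v \<in> V \<Longrightarrow> (c, v) \<in> eqcl r"
  shows "card (classes V r) = 1"
proof -
  have "eqcl r `` {v} = eqcl r `` {c}" if "v \<in> V" for v
    using eqcl_class_eq[OF assms(2)[OF that]] by simp
  then have "classes V r = {eqcl r `` {c}}" using assms(1) unfolding classes_def by blast
  then show ?thesis by simp
qed

text \<open>The new pair fuses the classes of \<open>a\<close> and \<open>b\<close> into one and
  leaves all others alone.\<close>

lemma card_classes_insert:
  assumes "finite V" "a \<in> V" "b \<in> V" "(a, b) \<notin> eqcl r"
  shows "card (classes V r) = Suc (card (classes V (insert (a, b) r)))"
proof -
  let ?K = "\<lambda>x. eqcl r `` {x}" and ?K' = "\<lambda>x. eqcl (insert (a, b) r) `` {x}"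
  have K': "?K' x = (if x \<in> ?K a \<union> ?K b then ?K a \<union> ?K b else ?K x)" for x
  proof (rule set_eqI)
    fix y
    have "(x, y) \<in> eqcl r \<longleftrightarrow> (a, y) \<in> eqcl r" if "(a, x) \<in> eqcl r"
      using eqcl_trans[OF that] eqcl_trans[OF eqcl_sym[OF that]] by blast
    moreover have "(x, y) \<in> eqcl r \<longleftrightarrow> (b, y) \<in> eqcl r" if "(b, x) \<in> eqcl r"
      using eqcl_trans[OF that] eqcl_trans[OF eqcl_sym[OF that]] by blast
    ultimately show "y \<in> ?K' x \<longleftrightarrow> y \<in> (if x \<in> ?K a \<union> ?K b then ?K a \<union> ?K b else ?K x)"
      using eqcl_insert_iff[of x y a b r] eqcl_sym_iff[of a x r] eqcl_sym_iff[of b x r] by auto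
  qed
  have ab: "?K a \<noteq> ?K b" using assms(4) by (simp add: eqcl_class_eq_iff)
  let ?R = "classes V r - {?K a, ?K b}"
  have R: "x \<notin> ?K a \<union> ?K b" if "?K x \<in> ?R" for x
  proof -
    from that have "?K x \<noteq> ?K a" "?K x \<noteq> ?K b" by auto
    then show ?thesis by (auto simp: eqcl_class_eq_iff dest: eqcl_sym)
  qed
  have eq: "classes V (insert (a, b) r) = insert (?K a \<union> ?K b) ?R"
  proof (intro equalityI subsetI)
    fix C assume "C \<in> classes V (insert (a, b) r)"
    then obtain x where x: "x \<in> V" "C = ?K' x" by (auto simp: classes_def)
    show "C \<in> insert (?K a \<union> ?K b) ?R"
    proof (cases "x \<in> ?K a \<union> ?K b")
      case False
      then have "?K x \<noteq> ?K a" "?K x \<noteq> ?K b" by auto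
      with x False K' show ?thesis by (auto simp: classes_def)
    qed (use x K' in simp)
  next
    fix C assume C: "C \<in> insert (?K a \<union> ?K b) ?R"
    show "C \<in> classes V (insert (a, b) r)"
    proof (cases "C \<in> ?R")
      case True
      then obtain x where x: "x \<in> V" "C = ?K x" by (auto simp: classes_def)
      with True R[of x] have "C = ?K' x" by (subst K') auto
      with x show ?thesis by (auto simp: classes_def)
    next
      case False
      with C have "C = ?K' a" by (subst K') auto
      with assms(2) show ?thesis by (auto simp: classes_def)
    qed
  qed
  \<comment> \<open>The fused class is new: an old class containing \<open>a\<close> is the class of
    \<open>a\<close>, which was removed from \<open>?R\<close>.\<close>
  have "?K a \<union> ?K b \<notin> ?R"
  proof
    assume *: "?K a \<union> ?K b \<in> ?R"
    then have "?K a \<union> ?K b = ?K a" by (metis DiffD1 UnI1 classes_memberD eqcl_refl Image_singleton_iff)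
    with * show False by auto
  qed
  then have "card (classes V (insert (a, b) r)) = Suc (card ?R)"
    unfolding eq using assms(1) by simp
  moreover have "{?K a, ?K b} \<subseteq> classes V r" using assms by (auto simp: classes_def)
  then have "card ?R = card (classes V r) - 2" "2 \<le> card (classes V r)"
    using ab assms(1) card_mono[of "classes V r" "{?K a, ?K b}"] by (simp_all add: card_Diff_subset)
  ultimately show ?thesis by simp
qed

section \<open>Components of a multigraph as classes of its adjacency relation\<close>

lemma arcs_ends_eq: "arcs_ends G = (\<lambda>e. (tail G e, head G e)) ` arcs G"
  by (simp add: arcs_ends_def arc_to_ends_def)

lemma (in wf_digraph) arcs_ends_subset: "arcs_ends G \<subseteq> verts G \<times> verts G"
  by (auto simp: arcs_ends_eq)

text \<open>Reachability demands that every visited point is a vertex; well-formedness provides this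
  once the starting point is one.\<close>

lemma (in wf_digraph) reachable_mk_symmetric_iff:
  "u \<rightarrow>\<^sup>*\<^bsub>with_proj (mk_symmetric G)\<^esub> v \<longleftrightarrow> u \<in> verts G \<and> (u, v) \<in> eqcl (arcs_ends G)"
proof -
  have sym: "arcs_ends (with_proj (mk_symmetric G)) = arcs_ends G \<union> (arcs_ends G)\<inverse>"
    by (auto simp: parcs_mk_symmetric arcs_ends_eq)
  show ?thesis
  proof
    assume "u \<rightarrow>\<^sup>*\<^bsub>with_proj (mk_symmetric G)\<^esub> v"
    then have "(u, v) \<in> rtrancl_on (verts G) (arcs_ends G \<union> (arcs_ends G)\<inverse>)"
      by (simp only: reachable_def sym) simp
    then show "u \<in> verts G \<and> (u, v) \<in> eqcl (arcs_ends G)"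
      unfolding eqcl_def by (induction rule: rtrancl_on_induct) (auto intro: rtrancl_into_rtrancl)
  next
    assume uv: "u \<in> verts G \<and> (u, v) \<in> eqcl (arcs_ends G)"
    then have "(u, v) \<in> (arcs_ends G \<union> (arcs_ends G)\<inverse>)\<^sup>*" by (simp add: eqcl_def)
    then have "(u, v) \<in> rtrancl_on (verts G) (arcs_ends G \<union> (arcs_ends G)\<inverse>)"
    proof (induction rule: rtrancl_induct)
      case (step y z)
      then have "z \<in> verts G" using arcs_ends_subset by auto
      with step show ?case by (blast intro: rtrancl_on_into_rtrancl_on)
    qed (use uv in simp)
    then show "u \<rightarrow>\<^sup>*\<^bsub>with_proj (mk_symmetric G)\<^esub> v"
      by (simp only: reachable_def sym) simp
  qed
qed

lemma (in wf_digraph) connected_iff: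
  "connected G \<longleftrightarrow> verts G \<noteq> {} \<and> (\<forall>u \<in> verts G. \<forall>v \<in> verts G. (u, v) \<in> eqcl (arcs_ends G))"
  unfolding connected_def strongly_connected_def by (auto simp: reachable_mk_symmetric_iff)

text \<open>In a symmetrized graph reachability is an equivalence on the vertices, so its maximal
  mutually reachable sets are the classes.\<close>

lemma (in wf_digraph) components_eq: "components G = classes (verts G) (arcs_ends G)"
proof (intro equalityI subsetI)
  fix S assume "S \<in> components G"
  then have S: "S \<noteq> {}" "\<And>u v. u \<in> S \<Longrightarrow> v \<in> S \<Longrightarrow> u \<in> verts G \<and> (u, v) \<in> eqcl (arcs_ends G)"
    "\<And>u v. u \<in> S \<Longrightarrow> v \<notin> S \<Longrightarrow> \<not> (u \<in> verts G \<and> v \<in> verts G \<and> (u, v) \<in> eqcl (arcs_ends G))"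
    unfolding components_def pre_digraph.sccs_verts_def
    by (auto simp: reachable_mk_symmetric_iff) (metis eqcl_sym)
  then obtain u where u: "u \<in> S" by blast
  have "S = eqcl (arcs_ends G) `` {u}"
  proof (intro equalityI subsetI)
    fix v assume "v \<in> eqcl (arcs_ends G) `` {u}"
    moreover from this have "v \<in> verts G"
      using eqcl_closed[of u v "arcs_ends G" "verts G"] S(2)[OF u u] arcs_ends_subset by auto
    ultimately show "v \<in> S" using S(2)[OF u u] S(3)[OF u, of v] by blast
  qed (use u S in auto)
  then show "S \<in> classes (verts G) (arcs_ends G)" using S(2)[OF u u] by (auto simp: classes_def)
next
  fix S assume S: "S \<in> classes (verts G) (arcs_ends G)"
  then have sub: "S \<subseteq> verts G" and ne: "S \<noteq> {}"
    using classes_closed arcs_ends_subset classes_nonempty by metis+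
  have "v \<in> S \<longleftrightarrow> (u, v) \<in> eqcl (arcs_ends G)" if "u \<in> S" for u v
    using classes_memberD[OF S that] by (metis Image_singleton_iff)
  then show "S \<in> components G"
    using sub ne unfolding components_def pre_digraph.sccs_verts_def
    by (simp add: reachable_mk_symmetric_iff subset_iff) blast
qed

section \<open>The circuit rank, one arc at a time\<close>

lemma fin_digraph_update_arcs:
  assumes "fin_digraph G" "A \<subseteq> arcs G"
  shows "fin_digraph (G\<lparr>arcs := A\<rparr>)"
proof -
  interpret fin_digraph G by fact
  show ?thesis using assms(2) finite_subset[OF assms(2) finite_arcs] by unfold_locales auto
qed

lemma wf_digraph_of_fin: "fin_digraph G \<Longrightarrow> wf_digraph G"
  by (simp add: fin_digraph_def)

lemma arcs_ends_insert:
  "arcs_ends (G\<lparr>arcs := insert e A\<rparr>) = insert (tail G e, head G e) (arcs_ends (G\<lparr>arcs := A\<rparr>))"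
  by (simp add: arcs_ends_eq)

text \<open>A new arc inside a component only raises the number of arcs; otherwise it also merges
  two components and the two changes cancel.\<close>

lemma circuit_rank_insert_arc:
  assumes "fin_digraph G" "insert e A \<subseteq> arcs G" "e \<notin> A"
  shows "circuit_rank (G\<lparr>arcs := insert e A\<rparr>) = circuit_rank (G\<lparr>arcs := A\<rparr>) +
    (if (tail G e, head G e) \<in> eqcl (arcs_ends (G\<lparr>arcs := A\<rparr>)) then 1 else 0)"
proof -
  interpret fin_digraph G by fact
  have *: "components (G\<lparr>arcs := B\<rparr>) = classes (verts G) (arcs_ends (G\<lparr>arcs := B\<rparr>))" if "B \<subseteq> arcs G" for B
    using wf_digraph.components_eq[OF wf_digraph_of_fin[OF fin_digraph_update_arcs[OF assms(1) that]]] by simp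
  have fin: "finite A" by (rule finite_subset[OF _ finite_arcs]) (use assms(2) in auto)
  show ?thesis
  proof (cases "(tail G e, head G e) \<in> eqcl (arcs_ends (G\<lparr>arcs := A\<rparr>))")
    case True
    then have "components (G\<lparr>arcs := insert e A\<rparr>) = components (G\<lparr>arcs := A\<rparr>)"
      using assms(2) by (simp add: * arcs_ends_insert classes_def eqcl_insert_redundant)
    then show ?thesis using True fin assms(3) by (simp add: circuit_rank_def)
  next
    case False
    then have "card (components (G\<lparr>arcs := A\<rparr>)) = Suc (card (components (G\<lparr>arcs := insert e A\<rparr>)))"
      using assms(2) by (simp add: * arcs_ends_insert) (rule card_classes_insert; simp)
    then show ?thesis using False fin assms(3) by (simp add: circuit_rank_def)
  qed
qed

lemma circuit_rank_no_arcs: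
  assumes "fin_digraph G"
  shows "circuit_rank (G\<lparr>arcs := {}\<rparr>) = 0"
proof -
  interpret fin_digraph G by fact
  have "components (G\<lparr>arcs := {}\<rparr>) = classes (verts G) (arcs_ends (G\<lparr>arcs := {}\<rparr>))"
    using wf_digraph.components_eq[OF wf_digraph_of_fin[OF fin_digraph_update_arcs[OF assms]]] by simp
  also have "\<dots> = (\<lambda>v. {v}) ` verts G"
    by (auto simp: classes_def arcs_ends_eq eqcl_def)
  finally show ?thesis by (simp add: circuit_rank_def card_image)
qed

lemma circuit_rank_nonneg:
  assumes "fin_digraph G"
  shows "0 \<le> circuit_rank G"
proof -
  interpret fin_digraph G by fact
  have "0 \<le> circuit_rank (G\<lparr>arcs := A\<rparr>)" if "A \<subseteq> arcs G" for A
    using finite_subset[OF that finite_arcs] that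
  proof (induction A rule: finite_induct)
    case empty
    show ?case by (simp only: circuit_rank_no_arcs[OF assms])
  next
    case (insert e A)
    then show ?case using circuit_rank_insert_arc[OF assms, of e A] by simp
  qed
  from this[of "arcs G"] show ?thesis by simp
qed

text \<open>Rank zero means that every arc is a bridge. Deleting a non-bridge would lower the rank
  below zero; conversely a bridge stays a bridge in every subgraph, so building up the graph arc by
  arc never raises the rank.\<close>

lemma circuit_rank_eq_0_iff:
  assumes "fin_digraph G"
  shows "circuit_rank G = 0 \<longleftrightarrow>
    (\<forall>e \<in> arcs G. (tail G e, head G e) \<notin> eqcl (arcs_ends (G\<lparr>arcs := arcs G - {e}\<rparr>)))"
proof -
  interpret fin_digraph G by fact
  have step: "circuit_rank G = circuit_rank (G\<lparr>arcs := arcs G - {e}\<rparr>) +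
    (if (tail G e, head G e) \<in> eqcl (arcs_ends (G\<lparr>arcs := arcs G - {e}\<rparr>)) then 1 else 0)"
    if "e \<in> arcs G" for e
    using circuit_rank_insert_arc[OF assms, of e "arcs G - {e}"] that by (simp add: insert_absorb)
  show ?thesis
  proof (intro iffI ballI)
    fix e assume "circuit_rank G = 0" "e \<in> arcs G"
    then show "(tail G e, head G e) \<notin> eqcl (arcs_ends (G\<lparr>arcs := arcs G - {e}\<rparr>))"
      using step[of e] circuit_rank_nonneg[OF fin_digraph_update_arcs[OF assms, of "arcs G - {e}"]]
      by (auto split: if_splits)
  next
    assume acyclic: "\<forall>e \<in> arcs G. (tail G e, head G e) \<notin> eqcl (arcs_ends (G\<lparr>arcs := arcs G - {e}\<rparr>))"
    have "circuit_rank (G\<lparr>arcs := A\<rparr>) = 0" if "A \<subseteq> arcs G" for A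
      using finite_subset[OF that finite_arcs] that
    proof (induction A rule: finite_induct)
      case empty
      show ?case by (simp only: circuit_rank_no_arcs[OF assms])
    next
      case (insert e A)
      have "(tail G e, head G e) \<notin> eqcl (arcs_ends (G\<lparr>arcs := A\<rparr>))"
      proof
        have "arcs_ends (G\<lparr>arcs := A\<rparr>) \<subseteq> arcs_ends (G\<lparr>arcs := arcs G - {e}\<rparr>)"
          using insert by (auto simp: arcs_ends_eq)
        moreover assume "(tail G e, head G e) \<in> eqcl (arcs_ends (G\<lparr>arcs := A\<rparr>))"
        ultimately have "(tail G e, head G e) \<in> eqcl (arcs_ends (G\<lparr>arcs := arcs G - {e}\<rparr>))"
          by (rule eqcl_mono)
        with acyclic insert.prems show False by blast
      qed
      then show ?case using insert circuit_rank_insert_arc[OF assms, of e A] by simp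
    qed
    from this[of "arcs G"] show "circuit_rank G = 0" by simp
  qed
qed

section \<open>Forests as graphs of circuit rank zero\<close>

lemma wf_both_directions: "wf_digraph G \<Longrightarrow> wf_digraph (both_directions G)"
  by (simp add: wf_digraph_def both_directions_def split_beta)

lemma arcs_ends_both_directions: "arcs_ends (both_directions G) = arcs_ends G \<union> (arcs_ends G)\<inverse>"
proof -
  have "arcs (both_directions G) = (\<lambda>e. (e, False)) ` arcs G \<union> (\<lambda>e. (e, True)) ` arcs G"
    by (simp add: both_directions_def set_eq_iff image_iff) blast
  then have "arcs_ends (both_directions G) =
      (\<lambda>e. (tail G e, head G e)) ` arcs G \<union> (\<lambda>e. (head G e, tail G e)) ` arcs G"
    by (simp add: arcs_ends_eq image_Un image_image) (simp add: both_directions_def)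
  then show ?thesis by (auto simp: arcs_ends_eq)
qed

text \<open>Both directions of the first edge have the starting vertex as an end, and a path does
  not come back to that vertex.\<close>

lemma apath_distinct_edges:
  assumes "wf_digraph G" "pre_digraph.apath (both_directions G) u p v"
  shows "distinct (map fst p)"
  using assms(2)
proof (induction p arbitrary: u)
  case (Cons x p)
  interpret wf_digraph "both_directions G" using assms(1) by (rule wf_both_directions)
  from Cons.prems have *: "u = tail (both_directions G) x" "apath (head (both_directions G) x) p v"
    "u \<notin> set (awalk_verts (head (both_directions G) x) p)" 
    by (auto simp: apath_Cons_iff)
  have "fst x \<noteq> fst y" if "y \<in> set p" for y
  proof
    assume xy: "fst x = fst y"
    have "awalk (head (both_directions G) x) p v" using * by (simp add: apath_def)
    then have "tail (both_directions G) y \<in> set (awalk_verts (head (both_directions G) x) p)"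
       "head (both_directions G) y \<in> set (awalk_verts (head (both_directions G) x) p)"
      using that by (auto simp: set_awalk_verts)
    with xy * show False by (cases x; cases y) (auto simp: both_directions_def split: if_splits)
  qed
  with Cons.IH[OF *(2)] show ?case by auto
qed simp

text \<open>If \<open>e\<close> is not a bridge, a path between its ends that avoids
  \<open>e\<close> closes up with \<open>e\<close> to a cycle. Conversely, a cycle with distinct
  edges stripped of its first edge joins the ends of that edge.\<close>

lemma undirected_forest_iff:
  assumes "wf_digraph G"
  shows "undirected_forest G \<longleftrightarrow>
    (\<forall>e \<in> arcs G. (tail G e, head G e) \<notin> eqcl (arcs_ends (G\<lparr>arcs := arcs G - {e}\<rparr>)))"
proof -
  have wf_del: "wf_digraph (G\<lparr>arcs := arcs G - {e}\<rparr>)" for e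
    using assms by (auto simp: wf_digraph_def)
  interpret B: wf_digraph "both_directions G" using assms by (rule wf_both_directions)
  have bd_del [simp]: "tail (both_directions (G\<lparr>arcs := A\<rparr>)) = tail (both_directions G)"
    "head (both_directions (G\<lparr>arcs := A\<rparr>)) = head (both_directions G)"
    "verts (both_directions (G\<lparr>arcs := A\<rparr>)) = verts (both_directions G)" for A
    by (auto simp: both_directions_def fun_eq_iff)
  have bd_simps: "verts (both_directions G) = verts G" "arcs (both_directions G) = arcs G \<times> UNIV"
    "tail (both_directions G) (e, False) = tail G e" "head (both_directions G) (e, False) = head G e" for e
    by (simp_all add: both_directions_def)
  \<comment> \<open>Neither \<open>cas\<close> nor \<open>awalk_verts\<close> looks at the set of
    arcs, so a path found after deleting \<open>e\<close> can be read in the full graph.\<close>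
  have cas_del: "pre_digraph.cas (both_directions (G\<lparr>arcs := A\<rparr>)) u p v = B.cas u p v" for A u p v
    by (induction p arbitrary: u) (auto simp: pre_digraph.cas.simps)
  have verts_del: "pre_digraph.awalk_verts (both_directions (G\<lparr>arcs := A\<rparr>)) u p = B.awalk_verts u p" for A u p
    by (induction p arbitrary: u) (auto simp: pre_digraph.awalk_verts.simps)
  show ?thesis
  proof (intro iffI ballI notI)
    fix e assume forest: "undirected_forest G" and e: "e \<in> arcs G"
      and th: "(tail G e, head G e) \<in> eqcl (arcs_ends (G\<lparr>arcs := arcs G - {e}\<rparr>))"
    define G' where "G' = G\<lparr>arcs := arcs G - {e}\<rparr>"
    interpret G': wf_digraph G' unfolding G'_def by (rule wf_del)
    interpret B': wf_digraph "both_directions G'" by (rule wf_both_directions) unfold_locales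
    have th_verts: "head G e \<in> verts G" "tail G e \<in> verts G" using assms e by (auto simp: wf_digraph_def)
    have "(head G e, tail G e) \<in> (arcs_ends (both_directions G'))\<^sup>*"
      using eqcl_sym[OF th] by (simp add: arcs_ends_both_directions G'_def eqcl_def)
    then have "head G e \<rightarrow>\<^sup>*\<^bsub>both_directions G'\<^esub> tail G e"
      using B'.reachable_conv[of "head G e" "tail G e"] th_verts by (simp add: G'_def both_directions_def)
    then obtain p where p: "B'.apath (head G e) p (tail G e)" by (auto simp: B'.reachable_apath)
    then have dist: "distinct (map fst p)" by (rule apath_distinct_edges[OF G'.wf_digraph_axioms])
    have "B'.awalk (head G e) p (tail G e)" "distinct (B'.awalk_verts (head G e) p)"
      using p by (simp_all add: B'.apath_def)
    then have "set p \<subseteq> arcs (both_directions G')" "B.cas (head G e) p (tail G e)"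
      "distinct (B.awalk_verts (head G e) p)"
      unfolding B'.awalk_def unfolding G'_def by (simp_all add: cas_del verts_del)
    then have "set p \<subseteq> (arcs G - {e}) \<times> UNIV" "B.cas (head G e) p (tail G e)"
      "distinct (B.awalk_verts (head G e) p)"
      by (simp_all add: G'_def both_directions_def)
    then have "B.cycle ((e, False) # p) \<and> distinct (map fst ((e, False) # p))"
      using dist e th_verts unfolding B.cycle_def B.awalk_def
      by (intro conjI exI[of _ "tail G e"]) (auto simp: bd_simps)
    with forest show False unfolding undirected_forest_def by blast
  next
    assume acyclic: "\<forall>e\<in>arcs G. (tail G e, head G e) \<notin> eqcl (arcs_ends (G\<lparr>arcs := arcs G - {e}\<rparr>))"
    show "undirected_forest G" unfolding undirected_forest_def
    proof
      assume "\<exists>p. B.cycle p \<and> distinct (map fst p)"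
      then obtain u p where p: "B.awalk u p u" "p \<noteq> []" "distinct (map fst p)" by (auto simp: B.cycle_def)
      then obtain e b q where q: "p = (e, b) # q" by (cases p) auto
      let ?r = "arcs_ends (G\<lparr>arcs := arcs G - {e}\<rparr>)"
      have e: "e \<in> arcs G" using p(1) q by (auto simp: B.awalk_def bd_simps)
      have walk: "(x, y) \<in> eqcl ?r" if "B.cas x s y" "set s \<subseteq> (arcs G - {e}) \<times> UNIV" for x y s
        using that
      proof (induction s arbitrary: x)
        case (Cons a s)
        have "(tail (both_directions G) a, head (both_directions G) a) \<in> eqcl ?r"
        proof (cases a)
          case (Pair f c)
          with Cons.prems have "f \<in> arcs G - {e}" by auto
          then have "(tail G f, head G f) \<in> eqcl ?r" by (intro eqcl_base) (auto simp: arcs_ends_eq)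
          then show ?thesis using Pair by (auto simp: both_directions_def intro: eqcl_sym)
        qed
        moreover have "(head (both_directions G) a, y) \<in> eqcl ?r" using Cons by auto
        ultimately show ?case using Cons.prems by (auto intro: eqcl_trans)
      qed simp
      have sq: "set q \<subseteq> (arcs G - {e}) \<times> UNIV"
      proof
        fix x assume "x \<in> set q"
        then have "x \<in> arcs (both_directions G)" "fst x \<in> fst ` set q" using p q by (auto simp: B.awalk_def)
        moreover have "e \<notin> fst ` set q" using p(3) q by simp
        ultimately have "fst x \<in> arcs G" "fst x \<noteq> e" by (auto simp: both_directions_def)
        then show "x \<in> (arcs G - {e}) \<times> UNIV" by (cases x) auto
      qed
      have "B.cas (head (both_directions G) (e, b)) q (tail (both_directions G) (e, b))"
        using p q by (auto simp: B.awalk_def)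
      from walk[OF this sq] have "(tail G e, head G e) \<in> eqcl ?r"
        by (auto simp: both_directions_def intro: eqcl_sym split: if_splits)
      with acyclic e show False by blast
    qed
  qed
qed

lemma undirected_forest_iff_circuit_rank:
  "fin_digraph G \<Longrightarrow> undirected_forest G \<longleftrightarrow> circuit_rank G = 0"
  by (simp add: undirected_forest_iff circuit_rank_eq_0_iff wf_digraph_of_fin)

section \<open>Orbits and faces\<close>

text \<open>Since \<open>orbit f x\<close> starts at \<open>f x\<close>, containing \<open>x\<close>
  means returning to it. An injective self-map of a finite set is a permutation there;
  \<open>perm_restrict\<close> makes it the identity elsewhere.\<close>

lemma inj_self_in_orbit:
  assumes "finite S" "f ` S \<subseteq> S" "inj_on f S" "x \<in> S"
  shows "x \<in> orbit f x"
proof -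
  let ?g = "perm_restrict f S"
  have "f ` S = S" using assms by (simp add: endo_inj_surj)
  then have "bij_betw f S S" using assms(3) by (simp add: bij_betw_def)
  then have "bij_betw ?g S S" by (subst bij_betw_cong[of S ?g f]) (auto simp: perm_restrict_def)
  then have "?g permutes S" by (rule bij_imp_permutes) (simp add: perm_restrict_def)
  then have "x \<in> orbit ?g x"
    using assms(1) by (intro permutation_self_in_orbit) (auto simp: permutation_permutes)
  moreover have "orbit ?g x = orbit f x"
    using assms by (intro orbit_cong0[of x S]) (auto simp: perm_restrict_def)
  ultimately show ?thesis by simp
qed

lemma orbit_subset_closed:
  assumes "f ` S \<subseteq> S" "x \<in> S"
  shows "orbit f x \<subseteq> S"
proof
  fix y assume "y \<in> orbit f x"
  then show "y \<in> S" by induction (use assms in auto)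
qed

lemma orbit_eq_orbit:
  assumes "x \<in> orbit f x" "y \<in> orbit f x"
  shows "orbit f y = orbit f x"
proof
  show "orbit f y \<subseteq> orbit f x" using orbit_trans[OF _ assms(2)] by blast
  show "orbit f x \<subseteq> orbit f y" using orbit_trans[OF _ orbit_swap[OF assms]] by blast
qed

section \<open>Orbits under composition with a transposition\<close>

definition orbits_avoiding :: "('a \<Rightarrow> 'a) \<Rightarrow> 'a set \<Rightarrow> 'a \<Rightarrow> 'a \<Rightarrow> 'a set set" where
  "orbits_avoiding f S a b = {X \<in> orbit f ` S. a \<notin> X \<and> b \<notin> X}"

lemma orbits_avoiding_subset:
  assumes "\<And>x. x \<in> S \<Longrightarrow> x \<in> orbit f x" "\<And>x. x \<noteq> a \<Longrightarrow> x \<noteq> b \<Longrightarrow> g x = f x"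
  shows "orbits_avoiding f S a b \<subseteq> orbits_avoiding g S a b"
proof
  fix X assume "X \<in> orbits_avoiding f S a b"
  then obtain x where x: "x \<in> S" "X = orbit f x" "a \<notin> X" "b \<notin> X"
    by (auto simp: orbits_avoiding_def)
  have "orbit g x = orbit f x"
  proof (rule orbit_cong)
    show "x \<in> orbit f x" using assms(1) x(1) .
    fix s assume "s \<in> orbit f x"
    then have "s \<noteq> a" "s \<noteq> b" using x by auto
    then show "g s = f s" by (rule assms(2))
  qed
  with x show "X \<in> orbits_avoiding g S a b" by (auto simp: orbits_avoiding_def)
qed

text \<open>The last summand is 1 or 2, according to whether \<open>a\<close> and \<open>b\<close>
  share an orbit.\<close>

lemma card_orbits_split:
  assumes "finite S" "\<And>x. x \<in> S \<Longrightarrow> x \<in> orbit f x" "a \<in> S" "b \<in> S"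
  shows "card (orbit f ` S) = card (orbits_avoiding f S a b) + card {orbit f a, orbit f b}"
proof -
  have "X \<in> {orbit f a, orbit f b}" if X: "X \<in> orbit f ` S" "a \<in> X \<or> b \<in> X" for X
  proof -
    from X(1) obtain x where x: "x \<in> S" "X = orbit f x" by auto
    have "y \<in> X \<Longrightarrow> orbit f y = X" for y unfolding x(2) by (rule orbit_eq_orbit[OF assms(2)[OF x(1)]])
    with X(2) show ?thesis by blast
  qed
  then have "orbit f ` S = orbits_avoiding f S a b \<union> {orbit f a, orbit f b}"
    using assms(3,4) by (auto simp: orbits_avoiding_def)
  moreover have "orbits_avoiding f S a b \<inter> {orbit f a, orbit f b} = {}"
    using assms(2)[OF assms(3)] assms(2)[OF assms(4)] by (auto simp: orbits_avoiding_def)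
  moreover have "finite (orbits_avoiding f S a b)" using assms(1) by (simp add: orbits_avoiding_def)
  ultimately show ?thesis using card_Un_disjoint[of "orbits_avoiding f S a b" "{orbit f a, orbit f b}"] by simp
qed

text \<open>Orbits through neither \<open>a\<close> nor \<open>b\<close> are the same for both maps,
  so only the one or two orbits through these points matter. They merge if they were
  distinct.\<close>

lemma card_orbits_transpose:
  assumes S: "finite S" "f ` S \<subseteq> S" "inj_on f S" and ab: "a \<in> S" "b \<in> S"
    and g: "g = f \<circ> Transposition.transpose a b"
  shows "card (orbit g ` S) \<le> Suc (card (orbit f ` S))"
    and "b \<notin> orbit f a \<Longrightarrow> Suc (card (orbit g ` S)) = card (orbit f ` S)"
proof -
  have tS: "Transposition.transpose a b ` S = S" using ab by (simp add: transpose_image_eq)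
  have self_f: "x \<in> orbit f x" if "x \<in> S" for x using inj_self_in_orbit[OF S that] .
  have "g ` S = f ` Transposition.transpose a b ` S" by (simp only: g image_comp)
  then have "g ` S \<subseteq> S" using S(2) tS by simp
  moreover have "inj_on g S" unfolding g
    by (rule comp_inj_on) (auto simp: tS S(3) intro: inj_on_subset[OF inj_transpose])
  ultimately have self_g: "x \<in> orbit g x" if "x \<in> S" for x
    using inj_self_in_orbit[OF S(1) _ _ that] by blast
  have fg: "g x = f x" if "x \<noteq> a" "x \<noteq> b" for x using that by (simp add: g transpose_apply_other)
  have "orbits_avoiding f S a b = orbits_avoiding g S a b"
    by (intro equalityI orbits_avoiding_subset) (auto simp: self_f self_g fg)
  then have eq: "card (orbit g ` S) + card {orbit f a, orbit f b} =
      card (orbit f ` S) + card {orbit g a, orbit g b}"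
    using card_orbits_split[OF S(1) self_f ab] card_orbits_split[OF S(1) self_g ab] by simp
  have two: "card {x, y} \<le> 2" "1 \<le> card {x, y}" for x y :: "'a set" by (simp_all add: card_insert_if)
  show "card (orbit g ` S) \<le> Suc (card (orbit f ` S))" using eq two(2)[of "orbit f a" "orbit f b"] two(1)[of "orbit g a" "orbit g b"] by linarith
  assume nb: "b \<notin> orbit f a"
  then have na: "a \<notin> orbit f b" using orbit_swap[OF self_f[OF ab(2)]] by blast
  have "orbit f a \<noteq> orbit f b" using nb self_f[OF ab(2)] by auto
  \<comment> \<open>From \<open>a\<close> the map \<open>g\<close> runs through the
    \<open>f\<close>-orbit of \<open>b\<close>: it starts with \<open>g a = f b\<close> and follows
    \<open>f\<close> as long as neither \<open>a\<close> nor \<open>b\<close> is met.\<close>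
  moreover have "y \<in> orbit g a" if "y \<in> orbit f b" for y
    using that
  proof induction
    case base
    have "f b = g a" by (simp add: g)
    then show ?case by (simp add: orbit.base)
  next
    case (step y)
    show ?case
    proof (cases "y = b")
      case True
      have "f b = g a" by (simp add: g)
      with True show ?thesis by (simp add: orbit.base)
    next
      case False
      moreover have "y \<noteq> a" using na step.hyps by blast
      ultimately have "f y = g y" by (simp add: fg)
      with step.IH show ?thesis by (simp add: orbit.step)
    qed
  qed
  then have "b \<in> orbit g a" using self_f ab by blast
  then have "orbit g b = orbit g a" by (rule orbit_eq_orbit[OF self_g[OF ab(1)]])
  ultimately show "Suc (card (orbit g ` S)) = card (orbit f ` S)" using eq by simp
qed

text \<open>Skipping the points outside \<open>T\<close> turns a cycle into a cycle on the remaining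
  points. This is what happens to a rotation when the edges of other colors are dropped.\<close>

lemma cyclic_on_first_return:
  assumes cyc: "cyclic_on f S" and ne: "T \<inter> S \<noteq> {}"
  shows "cyclic_on (first_return f T) (T \<inter> S)"
proof -
  let ?g = "first_return f T"
  have hit: "\<exists>m>0. m \<le> n \<and> ?g x = (f ^^ m) x \<and> (f ^^ m) x \<in> T" if "0 < n" "(f ^^ n) x \<in> T" for n x
  proof -
    let ?P = "\<lambda>n. 0 < n \<and> (f ^^ n) x \<in> T"
    have "?P (LEAST n. ?P n)" "(LEAST n. ?P n) \<le> n"
      using LeastI[of ?P n] Least_le[of ?P n] that by blast+
    then show ?thesis unfolding first_return_def by blast
  qed
  \<comment> \<open>Induction on the number of steps to \<open>y\<close>: a first return does not
    jump over \<open>y\<close>, as \<open>y\<close> itself lies in \<open>T\<close>.\<close>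
  have reach: "y \<in> orbit ?g x" if "0 < n" "(f ^^ n) x = y" "y \<in> T" for n x y
    using that
  proof (induction n arbitrary: x rule: less_induct)
    case (less n)
    then obtain m where m: "0 < m" "m \<le> n" "?g x = (f ^^ m) x" using hit by blast
    show ?case
    proof (cases "m = n")
      case True
      then have "?g x = y" using m less.prems by simp
      then show ?thesis using orbit.base[of ?g x] by simp
    next
      case False
      have "(f ^^ (n - m)) (?g x) = (f ^^ (n - m + m)) x" unfolding m(3) funpow_add by simp
      then have "(f ^^ (n - m)) (?g x) = y" using m less.prems by simp
      then have "y \<in> orbit ?g (?g x)" using less.IH[of "n - m" "?g x"] m False less.prems by simp
      then show ?thesis by (rule orbit_subset)
    qed
  qed
  have orb: "S = orbit f x" if "x \<in> S" for x using cyc that by (simp add: cyclic_on_alldef)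
  have "?g x \<in> T \<inter> S" if x: "x \<in> T \<inter> S" for x
  proof -
    obtain n where "0 < n" "(f ^^ n) x = x" using orb[of x] x by (auto simp: orbit_altdef)
    then obtain m where "?g x = (f ^^ m) x" "(f ^^ m) x \<in> T" using hit[of n x] x by auto
    then show ?thesis using cyclic_on_funpow_in[OF cyc, of x m] x by auto
  qed
  then have "orbit ?g x \<subseteq> T \<inter> S" if "x \<in> T \<inter> S" for x
    using that by (intro orbit_subset_closed) auto
  moreover have "y \<in> orbit ?g x" if "x \<in> T \<inter> S" "y \<in> T \<inter> S" for x y
  proof -
    have "y \<in> orbit f x" using orb[of x] that by auto
    then show ?thesis using reach that by (auto simp: orbit_altdef)
  qed
  ultimately show ?thesis unfolding cyclic_on_def using ne by blast
qed

text \<open>Every point of a cycle is the image of a point of the cycle, and a surjection of a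
  finite set onto itself is injective.\<close>

lemma cyclic_on_inj_on:
  assumes "cyclic_on f S"
  shows "inj_on f S"
proof (rule eq_card_imp_inj_on)
  show "finite S" using assms by (rule finite_cyclic_on)
  have "y \<in> f ` S" if "y \<in> S" for y
  proof -
    have y: "y \<in> orbit f y" "S = orbit f y" using assms that by (auto simp: cyclic_on_alldef)
    from y(1) show ?thesis by cases (use y that in auto)
  qed
  then have "f ` S = S" using cyclic_on_inI[OF assms] by blast
  then show "card (f ` S) = card S" by simp
qed

section \<open>Faces of a possibly disconnected map\<close>

text \<open>The properties of \<open>edge_colored_map\<close> that pass to the submap of one color,
  which need not be connected.\<close>

locale rotation_map =
  fixes N :: "('v, 'e) colored_map"
  assumes fin: "fin_digraph (mgraph N)"
    and cilia_verts: "cilia N \<subseteq> verts (mgraph N)"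
    and cyclic_rot: "\<And>v. v \<in> verts (mgraph N) \<Longrightarrow> darts_at N v \<noteq> {} \<Longrightarrow> cyclic_on (rot N) (darts_at N v)"
begin

sublocale fin_digraph "mgraph N" by (rule fin)

abbreviation "vx \<equiv> dart_vertex N"

abbreviation "bstep \<equiv> boundary_step N"

abbreviation "joins \<equiv> eqcl (arcs_ends (mgraph N))"

lemma finite_darts: "finite (darts N)"
proof -
  have "darts N = case_prod Half ` (arcs (mgraph N) \<times> UNIV) \<union> Cilium ` cilia N"
    by (auto simp: darts_def)
  moreover have "finite (cilia N)" using cilia_verts finite_verts by (rule finite_subset)
  ultimately show ?thesis by simp
qed

lemma Half_in_darts [simp]: "Half e b \<in> darts N \<longleftrightarrow> e \<in> arcs (mgraph N)"
  by (auto simp: darts_def)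

lemma Cilium_in_darts [simp]: "Cilium v \<in> darts N \<longleftrightarrow> v \<in> cilia N"
  by (auto simp: darts_def)

lemma vx_in_verts: "d \<in> darts N \<Longrightarrow> vx d \<in> verts (mgraph N)"
  using cilia_verts by (cases d) auto

lemma cyclic_rot_dart: "d \<in> darts N \<Longrightarrow> cyclic_on (rot N) (darts_at N (vx d))"
  by (rule cyclic_rot) (auto simp: vx_in_verts darts_at_def)

lemma rot_dart:
  assumes "d \<in> darts N"
  shows "rot N d \<in> darts N" "vx (rot N d) = vx d"
  using cyclic_on_inI[OF cyclic_rot_dart[OF assms], of d] assms by (auto simp: darts_at_def)

lemma inj_on_rot: "inj_on (rot N) (darts N)"
proof (rule inj_onI)
  fix d d' assume d: "d \<in> darts N" "d' \<in> darts N" "rot N d = rot N d'"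
  then have "vx d = vx d'" using rot_dart(2) by metis
  then show "d = d'"
    using cyclic_on_inj_on[OF cyclic_rot_dart[OF d(1)]] d by (auto simp: inj_on_def darts_at_def)
qed

lemma orbit_rot: "d \<in> darts N \<Longrightarrow> orbit (rot N) d = darts_at N (vx d)"
  by (rule orbit_cyclic_eq3[OF cyclic_rot_dart]) (auto simp: darts_at_def)

text \<open>Edges outside \<open>A\<close> are not crossed, so their darts are fixed like cilia. The
  set of darts thus stays the same while edges are switched on one by one.\<close>

definition opp_on :: "'e set \<Rightarrow> ('v, 'e) dart \<Rightarrow> ('v, 'e) dart" where
  "opp_on A d = (case d of Half e b \<Rightarrow> if e \<in> A then Half e (\<not> b) else d | Cilium v \<Rightarrow> d)"

definition step_on :: "'e set \<Rightarrow> ('v, 'e) dart \<Rightarrow> ('v, 'e) dart" where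
  "step_on A d = rot N (opp_on A d)"

lemma opp_on_dart: "d \<in> darts N \<Longrightarrow> opp_on A d \<in> darts N"
  by (cases d) (auto simp: opp_on_def)

lemma opp_on_opp_on: "opp_on A (opp_on A d) = d"
  by (cases d) (auto simp: opp_on_def)

lemma step_on_dart: "d \<in> darts N \<Longrightarrow> step_on A d \<in> darts N"
  by (simp add: step_on_def opp_on_dart rot_dart)

lemma inj_on_step_on: "inj_on (step_on A) (darts N)"
proof (rule inj_onI)
  fix d d' assume d: "d \<in> darts N" "d' \<in> darts N" "step_on A d = step_on A d'"
  then have "opp_on A d = opp_on A d'"
    using inj_on_rot by (simp add: step_on_def inj_on_eq_iff opp_on_dart)
  then show "d = d'" by (metis opp_on_opp_on)
qed

text \<open>A step crosses at most one edge, which lies in \<open>A\<close>, and then turns around a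
  vertex; so an orbit stays within one component.\<close>

lemma vx_step_on:
  assumes "d \<in> darts N"
  shows "(vx d, vx (step_on A d)) \<in> eqcl (arcs_ends (mgraph N \<lparr>arcs := A\<rparr>))"
proof -
  have "vx (step_on A d) = vx (opp_on A d)" by (simp add: step_on_def rot_dart opp_on_dart assms)
  moreover have "(vx d, vx (opp_on A d)) \<in> eqcl (arcs_ends (mgraph N \<lparr>arcs := A\<rparr>))"
  proof (cases "\<exists>e b. d = Half e b \<and> e \<in> A")
    case True
    then obtain e b where e: "d = Half e b" "e \<in> A" by blast
    then have "(tail (mgraph N) e, head (mgraph N) e) \<in> eqcl (arcs_ends (mgraph N \<lparr>arcs := A\<rparr>))"
      by (intro eqcl_base) (auto simp: arcs_ends_eq)
    then show ?thesis using e by (auto simp: opp_on_def intro: eqcl_sym)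
  next
    case False
    then have "opp_on A d = d" by (auto simp: opp_on_def split: dart.split)
    then show ?thesis by simp
  qed
  ultimately show ?thesis by simp
qed

lemma vx_orbit_step_on:
  assumes "d' \<in> orbit (step_on A) d" "d \<in> darts N"
  shows "d' \<in> darts N \<and> (vx d, vx d') \<in> eqcl (arcs_ends (mgraph N \<lparr>arcs := A\<rparr>))"
  using assms(1)
proof induction
  case base
  show ?case using vx_step_on step_on_dart assms(2) by blast
next
  case (step y)
  then show ?case using eqcl_trans[OF _ vx_step_on[of y A]] step_on_dart by blast
qed

lemma step_on_insert:
  assumes "e \<notin> A"
  shows "step_on (insert e A) = step_on A \<circ> Transposition.transpose (Half e False) (Half e True)"
proof
  fix d
  show "step_on (insert e A) d = (step_on A \<circ> Transposition.transpose (Half e False) (Half e True)) d"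
    using assms by (cases d) (auto simp: step_on_def opp_on_def Transposition.transpose_def)
qed

abbreviation "bare_verts \<equiv> {v \<in> verts (mgraph N). darts_at N v = {}}"

text \<open>Adding an edge to \<open>A\<close> multiplies the boundary permutation by a transposition: the number of
  orbits grows by at most one, and it drops when the edge merges two components.\<close>

lemma card_orbits_step_on:
  assumes "A \<subseteq> arcs (mgraph N)"
  shows "card (orbit (step_on A) ` darts N) + card bare_verts + card (verts (mgraph N))
    \<le> 2 * card (classes (verts (mgraph N)) (arcs_ends (mgraph N \<lparr>arcs := A\<rparr>))) + card A"
  using finite_subset[OF assms finite_arcs] assms
proof (induction A rule: finite_induct)
  case empty
  \<comment> \<open>With no edge switched on, the orbits are the rotations around the vertices that
    carry darts. Together with the bare vertices they number \<open>V\<close>, and the bound is an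
    equality.\<close>
  have "step_on {} = rot N" by (auto simp: fun_eq_iff step_on_def opp_on_def split: dart.split)
  moreover have "orbit (rot N) ` darts N = darts_at N ` (verts (mgraph N) - bare_verts)"
  proof (intro equalityI subsetI)
    fix X assume "X \<in> orbit (rot N) ` darts N"
    then obtain d where d: "d \<in> darts N" "X = darts_at N (vx d)" using orbit_rot by auto
    moreover have "d \<in> darts_at N (vx d)" using d by (simp add: darts_at_def)
    ultimately show "X \<in> darts_at N ` (verts (mgraph N) - bare_verts)"
      using vx_in_verts by blast
  next
    fix X assume "X \<in> darts_at N ` (verts (mgraph N) - bare_verts)"
    then obtain v d where "X = darts_at N v" "d \<in> darts_at N v" by blast
    then show "X \<in> orbit (rot N) ` darts N" using orbit_rot[of d] by (auto simp: darts_at_def)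
  qed
  moreover have "inj_on (darts_at N) (verts (mgraph N) - bare_verts)"
  proof (rule inj_onI)
    fix v w assume "v \<in> verts (mgraph N) - bare_verts" "darts_at N v = darts_at N w"
    then obtain d where "d \<in> darts_at N v" "d \<in> darts_at N w" by blast
    then show "v = w" by (simp add: darts_at_def)
  qed
  moreover have "card (verts (mgraph N) - bare_verts) + card bare_verts = card (verts (mgraph N))"
    using card_mono[of "verts (mgraph N)" bare_verts] by (simp add: card_Diff_subset)
  moreover have "classes (verts (mgraph N)) (arcs_ends (mgraph N \<lparr>arcs := {}\<rparr>)) = (\<lambda>v. {v}) ` verts (mgraph N)"
    by (auto simp: classes_def arcs_ends_eq eqcl_def)
  ultimately show ?case by (simp add: card_image)
next
  case (insert e A)
  let ?f = "step_on A" and ?g = "step_on (insert e A)" and ?r = "arcs_ends (mgraph N \<lparr>arcs := A\<rparr>)"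
  have ab: "Half e False \<in> darts N" "Half e True \<in> darts N" using insert.prems by simp_all
  have "?f ` darts N \<subseteq> darts N" using step_on_dart by blast
  note t = card_orbits_transpose[OF finite_darts this inj_on_step_on ab step_on_insert[OF insert.hyps(2)]]
  \<comment> \<open>An edge inside a component raises the right side by 1 and the orbits by at most
    1. A merging edge changes the right side by \<open>- 2 + 1\<close>, which the loss of one orbit
    compensates.\<close>
  show ?case
  proof (cases "(tail (mgraph N) e, head (mgraph N) e) \<in> eqcl ?r")
    case True
    then have "classes (verts (mgraph N)) (arcs_ends (mgraph N \<lparr>arcs := insert e A\<rparr>)) =
      classes (verts (mgraph N)) ?r"
      by (simp add: classes_def arcs_ends_insert eqcl_insert_redundant)
    then show ?thesis using t(1) insert by simp
  next
    case False
    have "Half e True \<notin> orbit ?f (Half e False)"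
    proof
      assume "Half e True \<in> orbit ?f (Half e False)"
      from vx_orbit_step_on[OF this ab(1)] False show False by simp
    qed
    note t(2)[OF this]
    moreover have "card (classes (verts (mgraph N)) ?r) =
        Suc (card (classes (verts (mgraph N)) (arcs_ends (mgraph N \<lparr>arcs := insert e A\<rparr>))))"
      unfolding arcs_ends_insert using False insert.prems by (intro card_classes_insert) auto
    ultimately show ?thesis using insert by simp
  qed
qed

lemma bstep_eq: "d \<in> darts N \<Longrightarrow> bstep d = step_on (arcs (mgraph N)) d"
  by (cases d) (auto simp: boundary_step_def step_on_def opp_on_def)

lemma orbit_bstep: "d \<in> darts N \<Longrightarrow> orbit bstep d = orbit (step_on (arcs (mgraph N))) d"
  by (rule orbit_cong0[of _ "darts N"]) (auto simp: bstep_eq step_on_dart)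

lemma bstep_self_in_orbit: "d \<in> darts N \<Longrightarrow> d \<in> orbit bstep d"
  unfolding orbit_bstep
  by (rule inj_self_in_orbit[OF finite_darts _ inj_on_step_on]) (auto simp: step_on_dart)

lemma vx_orbit_bstep:
  assumes "d \<in> darts N" "d' \<in> orbit bstep d"
  shows "d' \<in> darts N" "(vx d, vx d') \<in> joins"
  using vx_orbit_step_on[of d' "arcs (mgraph N)" d] assms by (auto simp: orbit_bstep)

definition closed_faces :: "('v, 'e) dart set set" where
  "closed_faces = {X \<in> orbit bstep ` darts N. X \<inter> range Cilium = {}}"

definition ciliated_faces :: "('v, 'e) dart set set" where
  "ciliated_faces = {X \<in> orbit bstep ` darts N. X \<inter> range Cilium \<noteq> {}}"

lemma finite_faces: "finite closed_faces" "finite ciliated_faces"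
  using finite_darts by (auto simp: closed_faces_def ciliated_faces_def)

text \<open>Euler's relation with nonnegative genus, summed over the components: there are at most
  \<open>2 k - V + E\<close> faces, which is \<open>k\<close> plus the circuit rank.\<close>

lemma euler_inequality:
  "int (card closed_faces + card bare_verts) + int (card ciliated_faces)
    \<le> int (card (components (mgraph N))) + circuit_rank (mgraph N)"
proof -
  have "orbit bstep ` darts N = closed_faces \<union> ciliated_faces"
    by (auto simp: closed_faces_def ciliated_faces_def)
  moreover have "closed_faces \<inter> ciliated_faces = {}"
    by (auto simp: closed_faces_def ciliated_faces_def)
  ultimately have "card (orbit bstep ` darts N) = card closed_faces + card ciliated_faces"
    using finite_faces by (simp add: card_Un_disjoint)
  moreover have "orbit bstep ` darts N = orbit (step_on (arcs (mgraph N))) ` darts N"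
    by (rule image_cong) (simp_all add: orbit_bstep)
  ultimately show ?thesis
    using card_orbits_step_on[of "arcs (mgraph N)"] by (simp add: circuit_rank_def components_eq)
qed

lemma card_components_split:
  "card (components (mgraph N)) = card {K \<in> components (mgraph N). K \<inter> cilia N = {}} +
     card {K \<in> components (mgraph N). K \<inter> cilia N \<noteq> {}}"
proof -
  have "components (mgraph N) = {K \<in> components (mgraph N). K \<inter> cilia N = {}} \<union>
     {K \<in> components (mgraph N). K \<inter> cilia N \<noteq> {}}" by blast
  moreover have "finite (components (mgraph N))" by (simp add: components_eq)
  ultimately show ?thesis by (subst \<open>components (mgraph N) = _\<close>, subst card_Un_disjoint) auto
qed

text \<open>A component without cilia is a bare vertex or contains a closed face, so sending faces
  and bare vertices to their components reaches all of these.\<close>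

lemma unciliated_components_le:
  "card {K \<in> components (mgraph N). K \<inter> cilia N = {}} \<le> card closed_faces + card bare_verts"
proof -
  \<comment> \<open>All darts of a face lie in the same component, so it does not matter which one
    \<open>SOME\<close> picks.\<close>
  define g where "g X = joins `` {vx (SOME d. d \<in> X)}" for X
  have "K \<in> g ` closed_faces \<union> (\<lambda>v. joins `` {v}) ` bare_verts"
    if K: "K \<in> components (mgraph N)" "K \<inter> cilia N = {}" for K
  proof -
    obtain x where x: "x \<in> verts (mgraph N)" "K = joins `` {x}"
      using K(1) by (auto simp: components_eq classes_def)
    show ?thesis
    proof (cases "darts_at N x = {}")
      case False
      then obtain d where d: "d \<in> darts N" "vx d = x" by (auto simp: darts_at_def)
      let ?X = "orbit bstep d"
      have X: "d' \<in> ?X \<Longrightarrow> d' \<in> darts N \<and> (x, vx d') \<in> joins" for d'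
        using vx_orbit_bstep d by blast
      have "?X \<inter> range Cilium = {}"
        using X K(2) x(2) by fastforce
      then have closed: "?X \<in> closed_faces" using d by (auto simp: closed_faces_def)
      have "(SOME d'. d' \<in> ?X) \<in> ?X" using bstep_self_in_orbit[OF d(1)] by (rule someI)
      then have "g ?X = K" using X eqcl_class_eq x(2) unfolding g_def by metis
      then show ?thesis using closed by blast
    qed (use x in blast)
  qed
  then have "{K \<in> components (mgraph N). K \<inter> cilia N = {}} \<subseteq> g ` closed_faces \<union> (\<lambda>v. joins `` {v}) ` bare_verts"
    by blast
  then have "card {K \<in> components (mgraph N). K \<inter> cilia N = {}}
      \<le> card (g ` closed_faces \<union> (\<lambda>v. joins `` {v}) ` bare_verts)"
    by (rule card_mono[rotated]) (simp add: finite_faces)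
  also have "\<dots> \<le> card (g ` closed_faces) + card ((\<lambda>v. joins `` {v}) ` bare_verts)"
    by (rule card_Un_le)
  also have "\<dots> \<le> card closed_faces + card bare_verts"
    by (intro add_mono card_image_le) (simp_all add: finite_faces)
  finally show ?thesis .
qed

section \<open>Broken faces and the permutation of the cilia\<close>

text \<open>The condition of \<open>broken_face\<close> for the map \<open>N\<close>. Leaving the
  cilium crosses no edge, hence \<open>Suc n\<close> steps for \<open>n\<close> edges.\<close>

definition breaks :: "nat \<Rightarrow> 'v \<Rightarrow> 'v \<Rightarrow> bool" where
  "breaks n v w \<longleftrightarrow> v \<in> cilia N \<and> w \<in> cilia N \<and>
     (\<forall>k \<in> {1..n}. (bstep ^^ k) (Cilium v) \<notin> range Cilium) \<and> (bstep ^^ Suc n) (Cilium v) = Cilium w"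

definition next_cilium :: "'v rel" where
  "next_cilium = {(v, w). \<exists>n. breaks n v w}"

lemma next_cilium_subset: "next_cilium \<subseteq> cilia N \<times> cilia N"
  by (auto simp: next_cilium_def breaks_def)

text \<open>The shorter of two broken faces would end at a cilium in the interior of the longer
  one.\<close>

lemma breaks_unique_length:
  assumes "breaks n v w" "breaks m v u"
  shows "n = m"
proof (rule ccontr)
  assume "n \<noteq> m"
  then consider "Suc n \<in> {1..m}" | "Suc m \<in> {1..n}" by force
  then show False
  proof cases
    case 1
    then have "(bstep ^^ Suc n) (Cilium v) \<notin> range Cilium" using assms(2) unfolding breaks_def by blast
    then show False using assms(1) unfolding breaks_def by (metis rangeI)
  next
    case 2
    then have "(bstep ^^ Suc m) (Cilium v) \<notin> range Cilium" using assms(1) unfolding breaks_def by blast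
    then show False using assms(2) unfolding breaks_def by (metis rangeI)
  qed
qed

lemma breaks_trivial:
  assumes "breaks 0 v w"
  shows "w = v"
proof -
  from assms have "v \<in> cilia N" "rot N (Cilium v) = Cilium w"
    by (auto simp: breaks_def boundary_step_def)
  then show ?thesis using rot_dart(2)[of "Cilium v"] by simp
qed

text \<open>Cutting the boundary walk at the first cilium it meets yields a broken face.\<close>

lemma breaks_exists:
  assumes "v \<in> cilia N" "0 < n" "(bstep ^^ n) (Cilium v) = Cilium w"
  shows "\<exists>m u. m < n \<and> breaks m v u \<and> (bstep ^^ Suc m) (Cilium v) = Cilium u"
proof -
  let ?P = "\<lambda>k. 0 < k \<and> (bstep ^^ k) (Cilium v) \<in> range Cilium"
  define m where "m = (LEAST k. ?P k)"
  have "?P n" using assms by simp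
  then have m: "?P m" "m \<le> n" unfolding m_def by (rule LeastI, intro Least_le)
  have least: "\<not> ?P k" if "k < m" for k using not_less_Least[of k ?P] that unfolding m_def by blast
  from m obtain u where u: "(bstep ^^ m) (Cilium v) = Cilium u" by blast
  have "(bstep ^^ m) (Cilium v) \<in> orbit bstep (Cilium v)" using m by (auto simp: orbit_altdef)
  then have "Cilium u \<in> darts N" using vx_orbit_bstep(1)[of "Cilium v" "Cilium u"] assms(1) u by simp
  then have "u \<in> cilia N" by simp
  moreover have "Suc (m - 1) = m" using m by simp
  moreover have "\<forall>k \<in> {1..m - 1}. (bstep ^^ k) (Cilium v) \<notin> range Cilium"
  proof
    fix k assume "k \<in> {1..m - 1}"
    then have "k < m" "0 < k" by auto
    then show "(bstep ^^ k) (Cilium v) \<notin> range Cilium" using least by blast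
  qed
  ultimately have "breaks (m - 1) v u" using assms(1) u unfolding breaks_def by metis
  then show ?thesis using u m \<open>Suc (m - 1) = m\<close> by (intro exI[of _ "m - 1"] exI[of _ u]) auto
qed

lemma next_cilium_exists: "v \<in> cilia N \<Longrightarrow> \<exists>n w. breaks n v w"
proof -
  assume v: "v \<in> cilia N"
  then have "Cilium v \<in> orbit bstep (Cilium v)" by (simp add: bstep_self_in_orbit)
  then obtain n where "0 < n" "(bstep ^^ n) (Cilium v) = Cilium v" by (auto simp: orbit_altdef)
  then show ?thesis using breaks_exists[OF v] by blast
qed

text \<open>The walk from one cilium to another is a concatenation of broken faces, cut off one
  after the other.\<close>

lemma orbit_next_cilium:
  assumes "v \<in> cilia N" "Cilium w \<in> orbit bstep (Cilium v)"
  shows "(v, w) \<in> eqcl next_cilium"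
proof -
  obtain n where "0 < n" "(bstep ^^ n) (Cilium v) = Cilium w" using assms(2) by (auto simp: orbit_altdef)
  then show ?thesis using assms(1)
  proof (induction n arbitrary: v rule: less_induct)
    case (less n)
    then obtain m u where m: "m < n" "breaks m v u" "(bstep ^^ Suc m) (Cilium v) = Cilium u"
      using breaks_exists by blast
    then have vu: "(v, u) \<in> eqcl next_cilium" "u \<in> cilia N"
      by (auto simp: next_cilium_def breaks_def intro!: eqcl_base)
    show ?case
    proof (cases "Suc m = n")
      case True
      then show ?thesis using m less.prems vu by simp
    next
      case False
      have "(bstep ^^ (n - Suc m)) (Cilium u) = (bstep ^^ (n - Suc m + Suc m)) (Cilium v)"
        unfolding m(3)[symmetric] funpow_add by simp
      then have "(bstep ^^ (n - Suc m)) (Cilium u) = Cilium w" using m(1) less.prems by simp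
      then have "(u, w) \<in> eqcl next_cilium"
        using less.IH[of "n - Suc m" u] m(1) False vu(2) by simp
      then show ?thesis using vu(1) eqcl_trans by metis
    qed
  qed
qed

text \<open>Cilia on the same face are equivalent, so sending a face to the class of any of its
  cilia is well defined and reaches every class.\<close>

lemma card_next_cilium_classes_le: "card (classes (cilia N) next_cilium) \<le> card ciliated_faces"
proof -
  define g where "g X = eqcl next_cilium `` {SOME w. Cilium w \<in> X}" for X :: "('v, 'e) dart set"
  have "K \<in> g ` ciliated_faces" if K: "K \<in> classes (cilia N) next_cilium" for K
  proof -
    obtain v where v: "v \<in> cilia N" "K = eqcl next_cilium `` {v}" using K by (auto simp: classes_def)
    let ?X = "orbit bstep (Cilium v)"
    have self: "Cilium v \<in> ?X" using v by (simp add: bstep_self_in_orbit)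
    then have "Cilium (SOME w. Cilium w \<in> ?X) \<in> ?X" by (rule someI)
    then have "(v, SOME w. Cilium w \<in> ?X) \<in> eqcl next_cilium" by (rule orbit_next_cilium[OF v(1)])
    then have "g ?X = K" using v(2) eqcl_class_eq unfolding g_def by metis
    moreover have "?X \<in> ciliated_faces" using self v(1) by (auto simp: ciliated_faces_def)
    ultimately show ?thesis by blast
  qed
  then have "card (classes (cilia N) next_cilium) \<le> card (g ` ciliated_faces)"
    by (intro card_mono) (auto simp: finite_faces)
  also have "\<dots> \<le> card ciliated_faces" by (rule card_image_le) (rule finite_faces)
  finally show ?thesis .
qed

lemma next_cilium_joins: "(v, w) \<in> next_cilium \<Longrightarrow> (v, w) \<in> joins"
proof -
  assume "(v, w) \<in> next_cilium"
  then obtain n where "v \<in> cilia N" "(bstep ^^ Suc n) (Cilium v) = Cilium w"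
    by (auto simp: next_cilium_def breaks_def)
  then have "Cilium w \<in> orbit bstep (Cilium v)" "Cilium v \<in> darts N"
    unfolding orbit_altdef by (auto intro: exI[of _ "Suc n"])
  then show ?thesis using vx_orbit_bstep(2) by fastforce
qed

text \<open>Broken faces do not leave a component, so a class of cilia determines its component, and
  every ciliated component arises in this way.\<close>

lemma card_ciliated_components_le:
  "card {K \<in> components (mgraph N). K \<inter> cilia N \<noteq> {}} \<le> card (classes (cilia N) next_cilium)"
proof -
  define g where "g X = joins `` X" for X
  have "K \<in> g ` classes (cilia N) next_cilium" if K: "K \<in> components (mgraph N)" "K \<inter> cilia N \<noteq> {}" for K
  proof -
    obtain v where v: "v \<in> cilia N" "v \<in> K" using K(2) by blast
    have eq: "K = joins `` {v}" using classes_memberD K(1) v(2) unfolding components_eq by metis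
    have "(v, w) \<in> joins" if "(v, w) \<in> eqcl next_cilium" for w
      using eqcl_least[of v w next_cilium "\<lambda>x. x"] that next_cilium_joins by blast
    then have "joins `` (eqcl next_cilium `` {v}) = joins `` {v}"
      using eqcl_trans[of v _ "arcs_ends (mgraph N)"] by blast
    then show ?thesis using v(1) unfolding eq g_def classes_def by blast
  qed
  moreover have fin: "finite (classes (cilia N) next_cilium)"
    using finite_subset[OF cilia_verts finite_verts] by simp
  ultimately have "card {K \<in> components (mgraph N). K \<inter> cilia N \<noteq> {}} \<le> card (g ` classes (cilia N) next_cilium)"
    by (intro card_mono) auto
  also have "\<dots> \<le> card (classes (cilia N) next_cilium)" by (rule card_image_le[OF fin])
  finally show ?thesis .
qed

end

section \<open>The boundary graph\<close>

lemma eqcl_image: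
  assumes "inj h"
  shows "eqcl (map_prod h h ` r) `` {h x} = h ` (eqcl r `` {x})"
proof (intro equalityI subsetI)
  fix y assume "y \<in> eqcl (map_prod h h ` r) `` {h x}"
  then have "(h x, y) \<in> (map_prod h h ` r \<union> (map_prod h h ` r)\<inverse>)\<^sup>*" by (simp add: eqcl_def)
  then show "y \<in> h ` (eqcl r `` {x})"
  proof (induction rule: rtrancl_induct)
    case (step y z)
    then obtain y' where y': "y = h y'" "(x, y') \<in> eqcl r" by blast
    from step.hyps(2) obtain z' where "z = h z'" "(y', z') \<in> r \<or> (z', y') \<in> r"
      using injD[OF assms] y'(1) by auto
    then have "z = h z'" "(y', z') \<in> eqcl r"
      using eqcl_base[of _ _ r] eqcl_sym[OF eqcl_base[of _ _ r]] by blast+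
    then show ?case using eqcl_trans[OF y'(2)] by blast
  qed simp
next
  fix y assume "y \<in> h ` (eqcl r `` {x})"
  then obtain z where z: "y = h z" "(x, z) \<in> eqcl r" by blast
  have "(h x, h z) \<in> eqcl (map_prod h h ` r)"
    using z(2) by (rule eqcl_least) (rule eqcl_base, force)
  then show "y \<in> eqcl (map_prod h h ` r) `` {h x}" using z(1) by simp
qed

text \<open>Lets the contracted pairs be replaced by the cilia that name them.\<close>

lemma card_classes_image:
  assumes "inj h"
  shows "card (classes (h ` V) (map_prod h h ` r)) = card (classes V r)"
proof -
  have "classes (h ` V) (map_prod h h ` r) = image h ` classes V r"
    by (simp add: classes_def image_image eqcl_image[OF assms])
  moreover have "inj_on (image h) (classes V r)"
    using assms by (intro inj_onI) (simp add: inj_image_eq_iff)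
  ultimately show ?thesis by (simp add: card_image)
qed

text \<open>Loops connect nothing; the edges deleted in the contraction are exactly of this
  kind.\<close>

lemma eqcl_Diff_Id: "eqcl (r - Id) = eqcl r"
proof -
  have "(x, y) \<in> eqcl (r - Id)" if "(x, y) \<in> r" for x y
    using that by (cases "x = y") (auto intro: eqcl_base[of _ _ "r - Id"])
  then have "(x, y) \<in> eqcl (r - Id)" if "(x, y) \<in> eqcl r" for x y
    using eqcl_least[of x y r "\<lambda>x. x" "r - Id"] that by blast
  moreover have "(x, y) \<in> eqcl r" if "(x, y) \<in> eqcl (r - Id)" for x y
    using that by (rule eqcl_mono[rotated]) blast
  ultimately show ?thesis by auto
qed

lemma classes_Diff_Id: "classes V (r - Id) = classes V r"
  by (simp add: classes_def eqcl_Diff_Id)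

section \<open>Submaps of a single color\<close>

lemma color_submap_simps [simp]:
  "mgraph (color_submap M i) = color_part M i"
  "cilia (color_submap M i) = cilia M"
  by (simp_all add: color_submap_def Let_def)

lemma color_part_simps [simp]:
  "verts (color_part G i) = verts (mgraph G)"
  "arcs (color_part G i) = {e \<in> arcs (mgraph G). color G e = i}"
  "tail (color_part G i) = tail (mgraph G)"
  "head (color_part G i) = head (mgraph G)"
  by (simp_all add: color_part_def)

lemma fin_digraph_color_part: "fin_digraph (mgraph G) \<Longrightarrow> fin_digraph (color_part G i)"
  unfolding color_part_def by (rule fin_digraph_update_arcs) auto

lemma darts_color_submap:
  "darts (color_submap M i) = {Half e b | e b. e \<in> arcs (mgraph M) \<and> color M e = i} \<union> Cilium ` cilia M"
  by (simp add: darts_def)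

lemma darts_at_color_submap: "darts_at (color_submap M i) v = darts (color_submap M i) \<inter> darts_at M v"
proof -
  have "dart_vertex (color_submap M i) d = dart_vertex M d" for d by (cases d) auto
  then show ?thesis by (auto simp: darts_at_def darts_color_submap) (auto simp: darts_def)
qed

lemma rot_color_submap: "rot (color_submap M i) = first_return (rot M) (darts (color_submap M i))"
  by (simp add: color_submap_def Let_def darts_def)

lemma rotation_map_color_submap:
  assumes "edge_colored_map D M"
  shows "rotation_map (color_submap M i)"
proof (rule rotation_map.intro)
  show "fin_digraph (mgraph (color_submap M i))"
    using assms by (simp add: edge_colored_map_def fin_digraph_color_part)
  show "cilia (color_submap M i) \<subseteq> verts (mgraph (color_submap M i))"
    using assms by (simp add: edge_colored_map_def)
  fix v assume v: "v \<in> verts (mgraph (color_submap M i))" "darts_at (color_submap M i) v \<noteq> {}"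
  then have "darts_at M v \<noteq> {}" by (auto simp: darts_at_color_submap)
  then have "cyclic_on (rot M) (darts_at M v)"
    using assms v(1) by (auto simp: edge_colored_map_def)
  then show "cyclic_on (rot (color_submap M i)) (darts_at (color_submap M i) v)"
    using v(2) unfolding rot_color_submap darts_at_color_submap by (rule cyclic_on_first_return)
qed

abbreviation next_cilium :: "('v, 'e) colored_map \<Rightarrow> nat \<Rightarrow> 'v rel" where
  "next_cilium M i \<equiv> rotation_map.next_cilium (color_submap M i)"

definition boundary_cycles :: "('v, 'e) colored_map \<Rightarrow> nat \<Rightarrow> nat" where
  "boundary_cycles M i = card (classes (cilia M) (next_cilium M i))"

definition ciliated_components :: "('v, 'e) colored_map \<Rightarrow> nat \<Rightarrow> 'v set set" where
  "ciliated_components M i = {K \<in> components (color_part M i). K \<inter> cilia M \<noteq> {}}"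

text \<open>In order: the genus is nonnegative; broken faces stay within a component; a component
  without cilia has a closed face.\<close>

lemma color_inequalities:
  assumes "edge_colored_map D M"
  shows "int (num_closed_faces M i) + int (boundary_cycles M i)
      \<le> int (card (components (color_part M i))) + circuit_rank (color_part M i)" (is ?euler)
    and "card (ciliated_components M i) \<le> boundary_cycles M i" (is ?cycles)
    and "card (components (color_part M i)) \<le> num_closed_faces M i + card (ciliated_components M i)" (is ?comps)
proof -
  interpret N: rotation_map "color_submap M i" using assms by (rule rotation_map_color_submap)
  have "{orbit N.bstep d | d. d \<in> darts (color_submap M i) \<and> orbit N.bstep d \<inter> range Cilium = {}} = N.closed_faces"
    by (auto simp: N.closed_faces_def)
  then have F: "num_closed_faces M i = card N.closed_faces + card N.bare_verts"
    by (simp add: num_closed_faces_def Let_def)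
  show ?euler
    using N.euler_inequality N.card_next_cilium_classes_le by (simp add: F boundary_cycles_def)
  show ?cycles
    using N.card_ciliated_components_le by (simp add: boundary_cycles_def ciliated_components_def)
  show ?comps
    using N.card_components_split N.unciliated_components_le by (simp add: F ciliated_components_def)
qed

section \<open>The boundary graph and its optimality\<close>

lemma boundary_graph_simps [simp]:
  "verts (mgraph (boundary_graph D M)) = White ` cilia M \<union> Black ` cilia M"
  "tail (mgraph (boundary_graph D M)) (i, v, w) = White v"
  "head (mgraph (boundary_graph D M)) (i, v, w) = Black w"
  "color (boundary_graph D M) (i, v, w) = i"
  by (simp_all add: boundary_graph_def)

text \<open>The edges that fill in missing colors correspond to the trivial broken faces, so all
  edges of color \<open>i\<close> together are the permutation of the cilia.\<close>

lemma arcs_boundary_graph: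
  assumes "edge_colored_map D M"
  shows "(i, v, w) \<in> arcs (mgraph (boundary_graph D M)) \<longleftrightarrow> i \<in> {1..D} \<and> (v, w) \<in> next_cilium M i"
proof -
  interpret N: rotation_map "color_submap M i" using assms by (rule rotation_map_color_submap)
  have bf: "broken_face M i n v w \<longleftrightarrow> N.breaks n v w" for n v w
    by (simp only: broken_face_def N.breaks_def Let_def color_submap_simps)
  have "(i, v, w) \<in> arcs (mgraph (boundary_graph D M)) \<longleftrightarrow> i \<in> {1..D} \<and>
    ((\<exists>n>0. N.breaks n v w) \<or> v = w \<and> v \<in> cilia M \<and> \<not> (\<exists>w. \<exists>n>0. N.breaks n v w))"
    by (auto simp: boundary_graph_def nontrivial_broken_face_def bf)
  also have "((\<exists>n>0. N.breaks n v w) \<or> v = w \<and> v \<in> cilia M \<and> \<not> (\<exists>w. \<exists>n>0. N.breaks n v w))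
    \<longleftrightarrow> (\<exists>n. N.breaks n v w)" (is "?L \<longleftrightarrow> ?R")
  proof
    assume ?L
    then show ?R
    proof
      assume L: "v = w \<and> v \<in> cilia M \<and> \<not> (\<exists>w. \<exists>n>0. N.breaks n v w)"
      have v: "v = w" "v \<in> cilia (color_submap M i)"
        and no: "\<forall>w n. n = 0 \<or> \<not> N.breaks n v w"
        using conjunct1[OF L] conjunct1[OF conjunct2[OF L]] conjunct2[OF conjunct2[OF L]] by simp_all
      \<comment> \<open>Some broken face starts at \<open>v\<close>; it has to be trivial and so
        returns to \<open>v\<close>.\<close>
      from N.next_cilium_exists[OF v(2)] obtain n u where n: "N.breaks n v u" by (elim exE)
      then have "n = 0" using spec[OF spec[OF no, of u], of n] by simp
      then have "u = v" using n N.breaks_trivial[of v u] by simp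
      then show ?R using n v(1) by (intro exI[of _ n]) simp
    qed blast
  next
    assume ?R
    then obtain n where n: "N.breaks n v w" by blast
    show ?L
    proof (cases "n = 0")
      case True
      with n have "w = v" using N.breaks_trivial[of v w] by simp
      moreover have "v \<in> cilia M" using n by (simp add: N.breaks_def)
      moreover have "\<not> (\<exists>w. \<exists>n>0. N.breaks n v w)"
        using N.breaks_unique_length[OF n] True by auto
      ultimately show ?L by blast
    qed (use n in auto)
  qed
  finally show ?thesis by (simp add: N.next_cilium_def)
qed

definition vertex_pair :: "'v \<Rightarrow> 'v boundary_vertex set" where
  "vertex_pair v = {White v, Black v}"

lemma inj_vertex_pair: "inj vertex_pair"
  by (rule injI) (auto simp: vertex_pair_def doubleton_eq_iff)

lemma induced_pairing_eq: "induced_pairing M = vertex_pair ` cilia M"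
  by (auto simp: induced_pairing_def vertex_pair_def)

lemma pair_of_induced_pairing:
  assumes "v \<in> cilia M"
  shows "pair_of (induced_pairing M) (White v) = vertex_pair v"
    "pair_of (induced_pairing M) (Black v) = vertex_pair v"
  unfolding pair_of_def using assms by (auto simp: induced_pairing_eq vertex_pair_def intro!: the_equality)

text \<open>Collapsing \<open>White v\<close> and \<open>Black v\<close> to \<open>v\<close> turns a
  path in the bubble into a chain of broken faces of various colors.\<close>

lemma boundary_bubble:
  assumes M: "edge_colored_map D M" and bubble: "bubble D (boundary_graph D M)"
  shows "cilia M \<noteq> {}"
    and "\<And>u v. u \<in> cilia M \<Longrightarrow> v \<in> cilia M \<Longrightarrow> (u, v) \<in> eqcl (\<Union>i \<in> {1..D}. next_cilium M i)"
proof -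
  interpret B: fin_digraph "mgraph (boundary_graph D M)" using bubble by (simp add: bubble_def)
  have conn: "verts (mgraph (boundary_graph D M)) \<noteq> {}"
    "\<And>x y. x \<in> verts (mgraph (boundary_graph D M)) \<Longrightarrow> y \<in> verts (mgraph (boundary_graph D M))
      \<Longrightarrow> (x, y) \<in> eqcl (arcs_ends (mgraph (boundary_graph D M)))"
    using bubble by (simp_all only: bubble_def B.connected_iff) blast+
  show "cilia M \<noteq> {}" using conn(1) by auto
  fix u v assume uv: "u \<in> cilia M" "v \<in> cilia M"
  let ?h = "\<lambda>x. case x of White v \<Rightarrow> v | Black v \<Rightarrow> v"
  have "(White u, White v) \<in> eqcl (arcs_ends (mgraph (boundary_graph D M)))"
    by (rule conn(2)) (use uv in auto)
  then have "(?h (White u), ?h (White v)) \<in> eqcl (\<Union>i \<in> {1..D}. next_cilium M i)"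
  proof (rule eqcl_least)
    fix x y assume "(x, y) \<in> arcs_ends (mgraph (boundary_graph D M))"
    then obtain i v w where "(i, v, w) \<in> arcs (mgraph (boundary_graph D M))" "x = White v" "y = Black w"
      by (auto simp: arcs_ends_eq)
    then show "(?h x, ?h y) \<in> eqcl (\<Union>i \<in> {1..D}. next_cilium M i)"
      by (intro eqcl_base) (auto simp: arcs_boundary_graph[OF M])
  qed
  then show "(u, v) \<in> eqcl (\<Union>i \<in> {1..D}. next_cilium M i)" by simp
qed

text \<open>Otherwise no broken face joins \<open>v\<close> to another cilium, in either direction,
  and the bubble would be disconnected.\<close>

lemma cilium_joined_to_other:
  assumes M: "edge_colored_map D M" and bubble: "bubble D (boundary_graph D M)"
    and v: "v \<in> cilia M" "cilia M \<noteq> {v}"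
  shows "\<exists>i \<in> {1..D}. \<exists>w \<in> cilia M. w \<noteq> v \<and> (v, w) \<in> eqcl (arcs_ends (color_part M i))"
proof (rule ccontr)
  assume no: "\<not> ?thesis"
  obtain u where u: "u \<in> cilia M" "u \<noteq> v" using v by blast
  have "u \<in> {v}"
  proof (rule eqcl_closed[OF boundary_bubble(2)[OF M bubble v(1) u(1)]])
    fix x y assume "(x, y) \<in> (\<Union>i \<in> {1..D}. next_cilium M i)"
    then obtain i where i: "i \<in> {1..D}" "(x, y) \<in> next_cilium M i" by blast
    interpret N: rotation_map "color_submap M i" using M by (rule rotation_map_color_submap)
    have "x \<in> cilia M" "y \<in> cilia M" using N.next_cilium_subset i(2) by auto
    moreover have "(x, y) \<in> eqcl (arcs_ends (color_part M i))" using N.next_cilium_joins[OF i(2)] by simp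
    ultimately show "x \<in> {v} \<longleftrightarrow> y \<in> {v}" using no i(1) eqcl_sym by (metis singleton_iff)
  qed simp
  with u show False by simp
qed

text \<open>The contracted graph has \<open>p\<close> vertices and one component, its part of color
  \<open>i\<close> has \<open>p\<close> vertices and \<open>boundary_cycles M i\<close> components.
  The edge counts cancel, since every edge has exactly one color.\<close>

lemma optimality_eq:
  assumes M: "edge_colored_map D M" and bubble: "bubble D (boundary_graph D M)"
  shows "optimality D (boundary_graph D M) (induced_pairing M) =
    (int D - 1) * int (card (cilia M)) + 1 - (\<Sum>i = 1..D. int (boundary_cycles M i))"
proof -
  let ?H = "contract (boundary_graph D M) (induced_pairing M)" and ?R = "next_cilium M"
    and ?p = "map_prod vertex_pair vertex_pair"
  have R: "?R i \<subseteq> cilia M \<times> cilia M" for i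
    using rotation_map.next_cilium_subset[OF rotation_map_color_submap[OF M, of i]] by simp
  have RC: "v \<in> cilia M" "w \<in> cilia M" if "(v, w) \<in> ?R i" for v w i
    using R[of i] that by auto
  have V: "verts (mgraph ?H) = vertex_pair ` cilia M" by (simp add: contract_def induced_pairing_eq)
  \<comment> \<open>Contraction deletes the edges from \<open>White v\<close> to
    \<open>Black v\<close>, which are the fixed points of the permutations.\<close>
  have A: "arcs (mgraph ?H) = {(i, v, w). i \<in> {1..D} \<and> (v, w) \<in> ?R i - Id}"
  proof -
    have "(\<exists>P \<in> induced_pairing M. White v \<in> P \<and> Black w \<in> P) \<longleftrightarrow> v = w" if "v \<in> cilia M" for v w
      using that by (auto simp: induced_pairing_eq vertex_pair_def)
    then show ?thesis using R by (fastforce simp: contract_def arcs_boundary_graph[OF M])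
  qed
  have ends: "tail (mgraph ?H) (i, v, w) = vertex_pair v" "head (mgraph ?H) (i, v, w) = vertex_pair w"
    if "(v, w) \<in> ?R i" for i v w
  proof -
    show "tail (mgraph ?H) (i, v, w) = vertex_pair v" "head (mgraph ?H) (i, v, w) = vertex_pair w"
      using RC[OF that] by (simp_all add: contract_def pair_of_induced_pairing)
  qed
  have color: "color ?H (i, v, w) = i" for i v w by (simp add: contract_def)
  have Ai: "arcs (color_part ?H i) = (\<lambda>(v, w). (i, v, w)) ` (?R i - Id)" if "i \<in> {1..D}" for i
    using that by (auto simp: A color)
  have finC: "finite (cilia M)" using M by (auto simp: edge_colored_map_def fin_digraph_def fin_digraph_axioms_def intro: finite_subset)
  then have finR: "finite (?R i)" for i using finite_subset[OF R[of i]] by simp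
  have wf: "wf_digraph (mgraph ?H)"
    using RC by unfold_locales (auto simp: A V ends intro!: imageI)
  then have wfi: "wf_digraph (color_part ?H i)" for i
    by (auto simp: wf_digraph_def)
  have ends_i: "arcs_ends (color_part ?H i) = ?p ` (?R i - Id)" if "i \<in> {1..D}" for i
    unfolding arcs_ends_eq Ai[OF that] image_image by (rule image_cong) (auto simp: ends)
  have ends_H: "arcs_ends (mgraph ?H) = ?p ` ((\<Union>i \<in> {1..D}. ?R i) - Id)"
  proof -
    have "arcs (mgraph ?H) = (\<Union>i \<in> {1..D}. arcs (color_part ?H i))" by (auto simp: A color)
    then have "arcs_ends (mgraph ?H) = (\<Union>i \<in> {1..D}. arcs_ends (color_part ?H i))"
      unfolding arcs_ends_eq color_part_simps(3,4) image_UN[symmetric] by (rule arg_cong)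
    also have "\<dots> = (\<Union>i \<in> {1..D}. ?p ` (?R i - Id))" by (rule SUP_cong) (simp_all only: ends_i)
    also have "\<dots> = ?p ` ((\<Union>i \<in> {1..D}. ?R i) - Id)" by blast
    finally show ?thesis .
  qed
  have verts: "card (vertex_pair ` cilia M) = card (cilia M)"
    by (rule card_image) (rule inj_on_subset[OF inj_vertex_pair], simp)
  have comp_i: "card (components (color_part ?H i)) = boundary_cycles M i" if "i \<in> {1..D}" for i
    by (simp add: wf_digraph.components_eq[OF wfi] V ends_i[OF that] boundary_cycles_def
        card_classes_image[OF inj_vertex_pair] classes_Diff_Id)
  have comp_H: "card (components (mgraph ?H)) = 1"
  proof -
    have "card (components (mgraph ?H)) = card (classes (cilia M) ((\<Union>i \<in> {1..D}. ?R i) - Id))"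
      by (simp add: wf_digraph.components_eq[OF wf] V ends_H card_classes_image[OF inj_vertex_pair])
    also have "\<dots> = card (classes (cilia M) (\<Union>i \<in> {1..D}. ?R i))" by (simp only: classes_Diff_Id)
    also have "\<dots> = 1"
    proof -
      obtain c where c: "c \<in> cilia M" using boundary_bubble(1)[OF M bubble] by blast
      show ?thesis by (rule card_classes_eq_1[OF c boundary_bubble(2)[OF M bubble c]])
    qed
    finally show ?thesis .
  qed
  have arcs_H: "card (arcs (mgraph ?H)) = (\<Sum>i = 1..D. card (arcs (color_part ?H i)))"
  proof -
    have "arcs (mgraph ?H) = (\<Union>i \<in> {1..D}. arcs (color_part ?H i))" by (auto simp: A color)
    also have "card \<dots> = (\<Sum>i = 1..D. card (arcs (color_part ?H i)))"
      by (rule card_UN_disjoint) (auto simp: Ai finR simp del: color_part_simps)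
    finally show ?thesis .
  qed
  have "(\<Sum>i = 1..D. circuit_rank (color_part ?H i)) =
    (\<Sum>i = 1..D. int (card (arcs (color_part ?H i))) - int (card (cilia M)) + int (boundary_cycles M i))"
    by (rule sum.cong) (simp_all add: circuit_rank_def comp_i V verts)
  then show ?thesis
    unfolding optimality_def
    by (simp add: circuit_rank_def[of "mgraph ?H"] comp_H V verts arcs_H sum.distrib sum_subtractf algebra_simps)
qed

section \<open>External forests\<close>

text \<open>No pair of \<open>r\<close> leaves \<open>U\<close>, so a chain that starts in
  \<open>U\<close> stays there.\<close>

lemma eqcl_restrict:
  assumes "x \<in> U" "\<And>a b. (a, b) \<in> r \<Longrightarrow> a \<in> U \<longleftrightarrow> b \<in> U"
  shows "eqcl (r \<inter> U \<times> U) `` {x} = eqcl r `` {x}"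
proof (intro equalityI subsetI)
  fix y assume "y \<in> eqcl (r \<inter> U \<times> U) `` {x}"
  then have "(x, y) \<in> eqcl (r \<inter> U \<times> U)" by simp
  then have "(x, y) \<in> eqcl r" by (rule eqcl_mono[rotated]) blast
  then show "y \<in> eqcl r `` {x}" by simp
next
  fix y assume "y \<in> eqcl r `` {x}"
  then have "(x, y) \<in> (r \<union> r\<inverse>)\<^sup>*" by (simp add: eqcl_def)
  then have "(x, y) \<in> eqcl (r \<inter> U \<times> U) \<and> y \<in> U"
  proof (induction rule: rtrancl_induct)
    case base
    show ?case using assms(1) by simp
  next
    case (step y z)
    then have "z \<in> U" "(y, z) \<in> r \<inter> U \<times> U \<or> (z, y) \<in> r \<inter> U \<times> U"
      using assms(2)[of y z] assms(2)[of z y] by blast+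
    then have "(y, z) \<in> eqcl (r \<inter> U \<times> U)"
      using eqcl_base[of y z "r \<inter> U \<times> U"] eqcl_sym[OF eqcl_base[of z y "r \<inter> U \<times> U"]] by blast
    then show ?case using step.IH \<open>z \<in> U\<close> eqcl_trans[of x y "r \<inter> U \<times> U" z] by blast
  qed
  then show "y \<in> eqcl (r \<inter> U \<times> U) `` {x}" by simp
qed

lemma classes_Union_subset:
  assumes "K \<subseteq> classes V r"
  shows "classes (\<Union> K) r = K"
proof (intro equalityI subsetI)
  fix X assume "X \<in> classes (\<Union> K) r"
  then obtain x Y where "X = eqcl r `` {x}" "x \<in> Y" "Y \<in> K" by (auto simp: classes_def)
  then show "X \<in> K" using classes_memberD[of Y V r x] assms by auto
next
  fix X assume X: "X \<in> K"
  then obtain x where x: "x \<in> X" using classes_nonempty[of X V r] assms by blast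
  then have "X = eqcl r `` {x}" using classes_memberD[of X V r x] X assms by blast
  then show "X \<in> classes (\<Union> K) r" using X x unfolding classes_def by blast
qed

text \<open>For the nontrivial direction, split off one set: any overlap with the union of the
  others makes the union bound strict.\<close>

lemma card_UN_eq_sum_iff:
  assumes "finite I" "\<And>i. i \<in> I \<Longrightarrow> finite (B i)"
  shows "card (\<Union>i \<in> I. B i) = (\<Sum>i \<in> I. card (B i)) \<longleftrightarrow> (\<forall>i \<in> I. \<forall>j \<in> I. i \<noteq> j \<longrightarrow> B i \<inter> B j = {})"
proof
  assume eq: "card (\<Union>i \<in> I. B i) = (\<Sum>i \<in> I. card (B i))"
  show "\<forall>i \<in> I. \<forall>j \<in> I. i \<noteq> j \<longrightarrow> B i \<inter> B j = {}"
  proof (intro ballI impI)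
    fix i j assume ij: "i \<in> I" "j \<in> I" "i \<noteq> j"
    let ?R = "\<Union>k \<in> I - {i}. B k"
    have "(\<Union>k \<in> I. B k) = B i \<union> ?R" using ij by auto
    moreover have fin: "finite (B i)" "finite ?R" using assms ij by auto
    ultimately have "card (\<Union>k \<in> I. B k) + card (B i \<inter> ?R) = card (B i) + card ?R"
      using card_Un_Int[of "B i" ?R] by simp
    moreover have "card ?R \<le> (\<Sum>k \<in> I - {i}. card (B k))" using assms(1) by (intro card_UN_le) simp
    moreover have "(\<Sum>k \<in> I. card (B k)) = card (B i) + (\<Sum>k \<in> I - {i}. card (B k))"
      using assms(1) ij by (simp add: sum.remove)
    ultimately have "card (B i \<inter> ?R) = 0" using eq by linarith
    then have "B i \<inter> ?R = {}" using fin by simp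
    then show "B i \<inter> B j = {}" using ij by blast
  qed
qed (use assms in \<open>intro card_UN_disjoint, auto\<close>)

text \<open>A bridge remains a bridge when other arcs are removed.\<close>

lemma undirected_forest_subgraph:
  assumes "wf_digraph G" "wf_digraph H" "undirected_forest G"
    and "arcs H \<subseteq> arcs G" "tail H = tail G" "head H = head G"
  shows "undirected_forest H"
  unfolding undirected_forest_iff[OF assms(2)]
proof (intro ballI notI)
  fix e assume e: "e \<in> arcs H" "(tail H e, head H e) \<in> eqcl (arcs_ends (H\<lparr>arcs := arcs H - {e}\<rparr>))"
  have "arcs_ends (H\<lparr>arcs := arcs H - {e}\<rparr>) \<subseteq> arcs_ends (G\<lparr>arcs := arcs G - {e}\<rparr>)"
    using assms(4-6) by (auto simp: arcs_ends_eq)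
  from eqcl_mono[OF this e(2)] have "(tail G e, head G e) \<in> eqcl (arcs_ends (G\<lparr>arcs := arcs G - {e}\<rparr>))"
    by (simp add: assms(5,6))
  then show False using assms(1,3,4) e(1) by (auto simp: undirected_forest_iff)
qed

section \<open>External trees and edge counts\<close>

text \<open>Nothing is assumed about the rotation, so edges can be removed freely. The last
  assumption is what is kept of the connectedness of the boundary graph.\<close>

locale ciliated_graph =
  fixes D :: nat and M :: "('v, 'e) colored_map"
  assumes fin: "fin_digraph (mgraph M)"
    and conn: "connected (mgraph M)"
    and colors: "e \<in> arcs (mgraph M) \<Longrightarrow> color M e \<in> {1..D}"
    and cilia_verts: "cilia M \<subseteq> verts (mgraph M)"
    and cilia_nonempty: "cilia M \<noteq> {}"
    and cilia_joined: "v \<in> cilia M \<Longrightarrow> cilia M \<noteq> {v} \<Longrightarrow>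
      \<exists>i \<in> {1..D}. \<exists>w \<in> cilia M. w \<noteq> v \<and> (v, w) \<in> eqcl (arcs_ends (color_part M i))"
begin

sublocale fin_digraph "mgraph M" by (rule fin)

abbreviation "V \<equiv> verts (mgraph M)"

abbreviation "joins i \<equiv> eqcl (arcs_ends (color_part M i))"

lemma finite_cilia: "finite (cilia M)"
  using cilia_verts finite_verts by (rule finite_subset)

lemma fin_color: "fin_digraph (color_part M i)"
  using fin by (rule fin_digraph_color_part)

lemma components_color: "components (color_part M i) = classes V (arcs_ends (color_part M i))"
  using wf_digraph.components_eq[OF wf_digraph_of_fin[OF fin_color]] by simp

lemma ends_color: "arcs_ends (color_part M i) \<subseteq> V \<times> V"
  using wf_digraph.arcs_ends_subset[OF wf_digraph_of_fin[OF fin_color]] by simp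

definition ext_components :: "nat \<Rightarrow> 'v set set" where
  "ext_components i = {K \<in> components (color_part M i). 2 \<le> card (K \<inter> cilia M)}"

lemma verts_ext_forest: "verts (ext_forest M i) = \<Union> (ext_components i)"
  by (simp add: ext_forest_def ext_components_def)

lemma arcs_ext_forest: "arcs (ext_forest M i) = {e \<in> arcs (mgraph M). color M e = i \<and>
    tail (mgraph M) e \<in> verts (ext_forest M i) \<and> head (mgraph M) e \<in> verts (ext_forest M i)}"
  by (auto simp: ext_forest_def induce_subgraph_def)

lemma ends_ext_forest [simp]:
  "tail (ext_forest M i) = tail (mgraph M)" "head (ext_forest M i) = head (mgraph M)"
  by (simp_all add: ext_forest_def induce_subgraph_def)

lemma verts_ext_forest_subset: "verts (ext_forest M i) \<subseteq> V"
  using classes_closed[OF _ ends_color] by (auto simp: verts_ext_forest ext_components_def components_color)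

lemma fin_ext_forest: "fin_digraph (ext_forest M i)"
proof
  show "finite (verts (ext_forest M i))"
    using verts_ext_forest_subset finite_verts by (rule finite_subset)
  show "finite (arcs (ext_forest M i))" by (simp add: arcs_ext_forest)
qed (simp_all add: arcs_ext_forest)

lemma ext_forest_memberD:
  assumes "v \<in> verts (ext_forest M i)"
  shows "joins i `` {v} \<in> ext_components i"
proof -
  obtain K where K: "v \<in> K" "K \<in> ext_components i" using assms by (auto simp: verts_ext_forest)
  then have "K = joins i `` {v}"
    by (intro classes_memberD[of K V]) (auto simp: ext_components_def components_color)
  with K show ?thesis by simp
qed

lemma ext_forest_memberI: "joins i `` {v} \<in> ext_components i \<Longrightarrow> v \<in> verts (ext_forest M i)"
  unfolding verts_ext_forest by blast

lemma ext_forest_saturated: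
  assumes "(v, w) \<in> arcs_ends (color_part M i)"
  shows "v \<in> verts (ext_forest M i) \<longleftrightarrow> w \<in> verts (ext_forest M i)"
proof -
  have "joins i `` {v} = joins i `` {w}" using eqcl_base[OF assms] by (rule eqcl_class_eq)
  then show ?thesis using ext_forest_memberD ext_forest_memberI by metis
qed

text \<open>The external forest is a union of whole components, so restricting to it breaks no
  connection.\<close>

lemma components_ext_forest: "components (ext_forest M i) = ext_components i"
proof -
  let ?U = "verts (ext_forest M i)" and ?r = "arcs_ends (color_part M i)"
  have "arcs_ends (ext_forest M i) = ?r \<inter> ?U \<times> ?U"
    by (auto simp: arcs_ends_eq arcs_ext_forest)
  then have "components (ext_forest M i) = classes ?U (?r \<inter> ?U \<times> ?U)"
    using wf_digraph.components_eq[OF wf_digraph_of_fin[OF fin_ext_forest]] by simp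
  also have "\<dots> = classes ?U ?r"
    unfolding classes_def using eqcl_restrict[OF _ ext_forest_saturated] by (intro image_cong) auto
  also have "\<dots> = ext_components i"
    unfolding verts_ext_forest
    by (rule classes_Union_subset[of _ V]) (auto simp: ext_components_def components_color)
  finally show ?thesis .
qed

lemma ciliated_components_eq:
  "ciliated_components M i = ext_components i \<union> {K \<in> components (color_part M i). card (K \<inter> cilia M) = 1}"
proof -
  have "K \<inter> cilia M \<noteq> {} \<longleftrightarrow> 2 \<le> card (K \<inter> cilia M) \<or> card (K \<inter> cilia M) = 1" for K
  proof -
    have "K \<inter> cilia M \<noteq> {} \<longleftrightarrow> card (K \<inter> cilia M) \<noteq> 0" using finite_cilia by simp
    then show ?thesis by linarith
  qed
  then show ?thesis by (auto simp: ciliated_components_def ext_components_def)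
qed

lemma class_in_components: "v \<in> V \<Longrightarrow> joins i `` {v} \<in> components (color_part M i)"
  by (auto simp: components_color classes_def)

text \<open>A cilium outside the external forest is alone in its component, and the component
  determines it.\<close>

lemma card_cilia_outside_ext_forest:
  "card (cilia M - verts (ext_forest M i)) = card {K \<in> components (color_part M i). card (K \<inter> cilia M) = 1}"
proof (rule bij_betw_same_card[of "\<lambda>v. joins i `` {v}"], rule bij_betw_imageI)
  show "inj_on (\<lambda>v. joins i `` {v}) (cilia M - verts (ext_forest M i))"
  proof (rule inj_onI, rule ccontr)
    fix v w assume vw: "v \<in> cilia M - verts (ext_forest M i)" "w \<in> cilia M - verts (ext_forest M i)"
      "joins i `` {v} = joins i `` {w}" "v \<noteq> w"
    then have "{v, w} \<subseteq> joins i `` {v} \<inter> cilia M" by auto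
    then have "card {v, w} \<le> card (joins i `` {v} \<inter> cilia M)"
      by (intro card_mono) (simp_all add: finite_cilia)
    then have "joins i `` {v} \<in> ext_components i"
      using vw class_in_components[of v i] cilia_verts by (auto simp: ext_components_def)
    then show False using ext_forest_memberI vw by blast
  qed
  show "(\<lambda>v. joins i `` {v}) ` (cilia M - verts (ext_forest M i)) =
    {K \<in> components (color_part M i). card (K \<inter> cilia M) = 1}" (is "?L = ?R")
  proof (intro equalityI subsetI)
    fix K assume "K \<in> ?L"
    then obtain v where v: "v \<in> cilia M" "v \<notin> verts (ext_forest M i)" "K = joins i `` {v}" by blast
    have K: "K \<in> components (color_part M i)" using class_in_components v cilia_verts by blast
    have "v \<in> K \<inter> cilia M" using v by simp
    then have "card (K \<inter> cilia M) \<noteq> 0" using finite_cilia by (metis card_0_eq emptyE finite_Int)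
    moreover have "\<not> 2 \<le> card (K \<inter> cilia M)"
      using v K ext_forest_memberI[of i v] by (auto simp: ext_components_def)
    ultimately have "card (K \<inter> cilia M) = 1" by linarith
    with K show "K \<in> ?R" by simp
  next
    fix K assume K: "K \<in> ?R"
    then obtain v where v: "K \<inter> cilia M = {v}" by (auto simp: card_1_singleton_iff)
    then have eq: "K = joins i `` {v}"
      using K by (intro classes_memberD[of K V]) (auto simp: components_color)
    moreover have "v \<notin> verts (ext_forest M i)"
    proof
      assume "v \<in> verts (ext_forest M i)"
      then have "K \<in> ext_components i" using ext_forest_memberD eq by blast
      then show False using v by (simp add: ext_components_def)
    qed
    ultimately show "K \<in> ?L" using v by blast
  qed
qed

text \<open>Components with exactly one cilium contribute equally to both numbers on the left and
  cancel.\<close>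

lemma card_cilia_minus_components:
  "int (card (cilia M)) - int (card (ciliated_components M i)) =
    int (card (verts (ext_forest M i) \<inter> cilia M)) - int (card (ext_components i))"
proof -
  have "finite (components (color_part M i))" by (simp add: components_color)
  then have "card (ciliated_components M i) = card (ext_components i) +
      card {K \<in> components (color_part M i). card (K \<inter> cilia M) = 1}"
    unfolding ciliated_components_eq by (intro card_Un_disjoint) (auto simp: ext_components_def)
  moreover have "card (cilia M) = card (cilia M \<inter> verts (ext_forest M i)) + card (cilia M - verts (ext_forest M i))"
    using finite_cilia by (simp add: card_Diff_subset_Int card_mono)
  ultimately show ?thesis by (simp add: card_cilia_outside_ext_forest Int_commute)
qed

definition other_arcs :: "nat \<Rightarrow> 'e set" where
  "other_arcs i = arcs (color_part M i) - arcs (ext_forest M i)"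

text \<open>Both sides count the edges of color \<open>i\<close>. The external trees have as many
  edges as vertices minus trees; their ciliated vertices minus trees are replaced by
  \<open>card_cilia_minus_components\<close>.\<close>

lemma color_part_forest_count:
  assumes "undirected_forest (color_part M i)"
  shows "int (card V) - int (card (components (color_part M i))) =
    int (card (verts (ext_forest M i) - cilia M)) +
    (int (card (cilia M)) - int (card (ciliated_components M i))) + int (card (other_arcs i))"
proof -
  have "circuit_rank (color_part M i) = 0"
    using assms by (simp add: undirected_forest_iff_circuit_rank[OF fin_color])
  then have "int (card V) - int (card (components (color_part M i))) = int (card (arcs (color_part M i)))"
    by (simp add: circuit_rank_def)
  moreover have sub: "arcs (ext_forest M i) \<subseteq> arcs (color_part M i)" by (auto simp: arcs_ext_forest)
  then have "card (arcs (color_part M i)) = card (arcs (ext_forest M i)) + card (other_arcs i)"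
    unfolding other_arcs_def using card_Diff_subset[OF finite_subset[OF sub] sub] card_mono[OF _ sub]
    by simp
  moreover have "undirected_forest (ext_forest M i)"
    by (rule undirected_forest_subgraph[OF wf_digraph_of_fin[OF fin_color] wf_digraph_of_fin[OF fin_ext_forest] assms sub])
      simp_all
  then have "circuit_rank (ext_forest M i) = 0"
    by (simp add: undirected_forest_iff_circuit_rank[OF fin_ext_forest])
  then have "int (card (arcs (ext_forest M i))) = int (card (verts (ext_forest M i))) - int (card (ext_components i))"
    by (simp add: circuit_rank_def components_ext_forest)
  moreover have "finite (verts (ext_forest M i))" using verts_ext_forest_subset finite_verts by (rule finite_subset)
  then have "card (verts (ext_forest M i)) = card (verts (ext_forest M i) \<inter> cilia M) + card (verts (ext_forest M i) - cilia M)"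
    by (simp add: card_Diff_subset_Int card_mono)
  ultimately show ?thesis using card_cilia_minus_components[of i] by simp
qed

text \<open>This is \<open>X\<close> of the opening remarks. It sees the edges only through the
  monochromatic components.\<close>

definition excess :: int where
  "excess = (int D - 1) * (int (card V) - int (card (cilia M))) -
     (\<Sum>i = 1..D. int (card (components (color_part M i))) - int (card (ciliated_components M i)))"

lemma arcs_non_ext_graph:
  "arcs (non_ext_graph D M) = arcs (mgraph M) - (\<Union>i \<in> {1..D}. arcs (ext_forest M i))"
  by (simp add: non_ext_graph_def Let_def)

lemma card_arcs_non_ext_graph: "card (arcs (non_ext_graph D M)) = (\<Sum>i = 1..D. card (other_arcs i))"
proof -
  have "arcs (non_ext_graph D M) = (\<Union>i \<in> {1..D}. other_arcs i)"
    using colors by (auto simp: arcs_non_ext_graph other_arcs_def arcs_ext_forest)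
  also have "card \<dots> = (\<Sum>i = 1..D. card (other_arcs i))"
    by (rule card_UN_disjoint) (auto simp: other_arcs_def)
  finally show ?thesis .
qed

text \<open>With \<open>p\<close> cilia, \<open>k\<close> components and \<open>c\<close> ciliated
  ones per color, \<open>excess\<close> is the sum of \<open>(V - k) - (p - c)\<close> over the
  colors, minus one copy of \<open>V - p\<close>.\<close>

lemma excess_forest:
  assumes "monochromatic_forests D M"
  shows "excess = int (card (arcs (non_ext_graph D M))) +
    (\<Sum>i = 1..D. int (card (verts (ext_forest M i) - cilia M))) - int (card (V - cilia M))"
proof -
  have "(\<Sum>i = 1..D. int (card V) - int (card (components (color_part M i)))) =
    (\<Sum>i = 1..D. int (card (verts (ext_forest M i) - cilia M)) +
    (int (card (cilia M)) - int (card (ciliated_components M i))) + int (card (other_arcs i)))"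
    using assms by (intro sum.cong color_part_forest_count) (auto simp: monochromatic_forests_def)
  moreover have "int (card (V - cilia M)) = int (card V) - int (card (cilia M))"
    using card_Diff_subset[OF finite_cilia cilia_verts] card_mono[OF finite_verts cilia_verts] by simp
  ultimately show ?thesis
    unfolding excess_def card_arcs_non_ext_graph
    by (simp add: sum.distrib sum_subtractf algebra_simps)
qed

section \<open>The edges outside the external forests\<close>

lemma ends_non_ext_graph [simp]:
  "tail (non_ext_graph D M) = tail (mgraph M)" "head (non_ext_graph D M) = head (mgraph M)"
  by (simp_all add: non_ext_graph_def Let_def)

lemma verts_non_ext_graph: "verts (non_ext_graph D M) =
    tail (mgraph M) ` arcs (non_ext_graph D M) \<union> head (mgraph M) ` arcs (non_ext_graph D M)"
  by (simp add: non_ext_graph_def Let_def)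

lemma arcs_non_ext_subset: "arcs (non_ext_graph D M) \<subseteq> arcs (mgraph M)"
  by (auto simp: arcs_non_ext_graph)

lemma fin_non_ext_graph: "fin_digraph (non_ext_graph D M)"
proof -
  have "finite (arcs (non_ext_graph D M))" using arcs_non_ext_subset finite_arcs by (rule finite_subset)
  then show ?thesis by unfold_locales (auto simp: verts_non_ext_graph)
qed

lemma verts_non_ext_subset: "verts (non_ext_graph D M) \<subseteq> V"
  using arcs_non_ext_subset by (auto simp: verts_non_ext_graph)

lemma components_non_ext_graph:
  "components (non_ext_graph D M) = classes (verts (non_ext_graph D M)) (arcs_ends (non_ext_graph D M))"
  by (rule wf_digraph.components_eq[OF wf_digraph_of_fin[OF fin_non_ext_graph]])

lemma ext_verts_subset: "ext_verts D M \<subseteq> V"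
  using verts_ext_forest_subset by (auto simp: ext_verts_def)

lemma arc_outside_ext_verts:
  assumes "e \<in> arcs (mgraph M)" "tail (mgraph M) e \<notin> ext_verts D M \<or> head (mgraph M) e \<notin> ext_verts D M"
  shows "e \<in> arcs (non_ext_graph D M)"
  using assms by (auto simp: arcs_non_ext_graph arcs_ext_forest ext_verts_def)

text \<open>Edges of external trees have both ends in \<open>ext_verts\<close>. A class of the other
  edges that misses \<open>ext_verts\<close> would therefore be closed under all edges, against
  connectedness.\<close>

lemma joined_to_ext_verts:
  assumes "x \<in> V" "ext_verts D M \<noteq> {}"
  shows "\<exists>w \<in> ext_verts D M. (x, w) \<in> eqcl (arcs_ends (non_ext_graph D M))"
proof (rule ccontr)
  let ?r = "arcs_ends (non_ext_graph D M)"
  assume no: "\<not> ?thesis"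
  obtain w where w: "w \<in> ext_verts D M" using assms(2) by blast
  then have "(x, w) \<in> eqcl (arcs_ends (mgraph M))"
    using conn assms(1) ext_verts_subset by (auto simp: connected_iff)
  moreover have "x \<in> eqcl ?r `` {x}" by simp
  ultimately have "w \<in> eqcl ?r `` {x}"
  proof (rule eqcl_closed)
    fix a b assume "(a, b) \<in> arcs_ends (mgraph M)"
    then obtain e where e: "e \<in> arcs (mgraph M)" "a = tail (mgraph M) e" "b = head (mgraph M) e"
      by (auto simp: arcs_ends_eq)
    show "a \<in> eqcl ?r `` {x} \<longleftrightarrow> b \<in> eqcl ?r `` {x}"
    proof (cases "e \<in> arcs (non_ext_graph D M)")
      case True
      then have "(a, b) \<in> eqcl ?r" using e by (intro eqcl_base) (auto simp: arcs_ends_eq)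
      then show ?thesis using eqcl_trans[of x a ?r b] eqcl_trans[of x b ?r a] eqcl_sym[of a b ?r] by blast
    next
      case False
      then have "a \<in> ext_verts D M" "b \<in> ext_verts D M" using arc_outside_ext_verts e by blast+
      then show ?thesis using no by blast
    qed
  qed
  then show False using no w by blast
qed

text \<open>The vertices of \<open>non_ext_graph\<close> are the ends of its edges. A vertex
  incident to none of them is joined only to itself, hence is external.\<close>

lemma verts_outside_ext_verts:
  assumes "ext_verts D M \<noteq> {}"
  shows "V - ext_verts D M \<subseteq> verts (non_ext_graph D M)"
proof
  fix x assume x: "x \<in> V - ext_verts D M"
  then obtain w where w: "w \<in> ext_verts D M" "(x, w) \<in> eqcl (arcs_ends (non_ext_graph D M))"
    using joined_to_ext_verts assms by blast
  show "x \<in> verts (non_ext_graph D M)"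
  proof (rule ccontr)
    assume x': "x \<notin> verts (non_ext_graph D M)"
    have "w \<in> {x}" by (rule eqcl_closed[OF w(2)]) (use x' in \<open>auto simp: arcs_ends_eq verts_non_ext_graph\<close>)
    then show False using w x by blast
  qed
qed

text \<open>The number of edges is vertices minus components plus circuit rank. The vertices are
  those off \<open>ext_verts\<close> and those where a component meets it; each component uses up
  one of the latter.\<close>

lemma card_non_ext_arcs:
  assumes ne: "ext_verts D M \<noteq> {}"
  shows "int (card (arcs (non_ext_graph D M))) = int (card (V - ext_verts D M)) +
    circuit_rank (non_ext_graph D M) +
    (\<Sum>K \<in> components (non_ext_graph D M). int (card (K \<inter> ext_verts D M)) - 1)"
    and "\<And>K. K \<in> components (non_ext_graph D M) \<Longrightarrow> 1 \<le> card (K \<inter> ext_verts D M)"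
proof -
  let ?N = "non_ext_graph D M" and ?W = "ext_verts D M"
  have finW: "finite ?W" using ext_verts_subset finite_verts by (rule finite_subset)
  have finN: "finite (verts ?N)" using verts_non_ext_subset finite_verts by (rule finite_subset)
  have fink: "finite (components ?N)" using finN by (simp add: components_non_ext_graph)
  have "verts ?N = (V - ?W) \<union> (verts ?N \<inter> ?W)"
    using verts_outside_ext_verts[OF ne] verts_non_ext_subset by blast
  moreover have "card ((V - ?W) \<union> (verts ?N \<inter> ?W)) = card (V - ?W) + card (verts ?N \<inter> ?W)"
    using finW by (intro card_Un_disjoint) auto
  ultimately have "card (verts ?N) = card (V - ?W) + card (verts ?N \<inter> ?W)" by metis
  moreover have "card (verts ?N \<inter> ?W) = (\<Sum>K \<in> components ?N. card (K \<inter> ?W))"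
  proof -
    have "\<Union> (components ?N) = verts ?N" unfolding components_non_ext_graph
      by (rule classes_Union) (rule wf_digraph.arcs_ends_subset[OF wf_digraph_of_fin[OF fin_non_ext_graph]])
    then have "verts ?N \<inter> ?W = (\<Union>K \<in> components ?N. K \<inter> ?W)" by blast
    also have "card \<dots> = (\<Sum>K \<in> components ?N. card (K \<inter> ?W))"
    proof (rule card_UN_disjoint[OF fink])
      show "\<forall>K \<in> components ?N. finite (K \<inter> ?W)" using finW by simp
      show "\<forall>K \<in> components ?N. \<forall>L \<in> components ?N. K \<noteq> L \<longrightarrow> (K \<inter> ?W) \<inter> (L \<inter> ?W) = {}"
      proof (intro ballI impI)
        fix K L assume "K \<in> components ?N" "L \<in> components ?N" "K \<noteq> L"
        then have "K \<inter> L = {}" unfolding components_non_ext_graph by (rule classes_disjoint)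
        then show "(K \<inter> ?W) \<inter> (L \<inter> ?W) = {}" by blast
      qed
    qed
    finally show ?thesis .
  qed
  ultimately show "int (card (arcs ?N)) = int (card (V - ?W)) + circuit_rank ?N +
    (\<Sum>K \<in> components ?N. int (card (K \<inter> ?W)) - 1)"
    by (simp add: circuit_rank_def sum_subtractf)
  fix K assume K: "K \<in> components ?N"
  then obtain x where x: "x \<in> verts ?N" "K = eqcl (arcs_ends ?N) `` {x}"
    by (auto simp: components_non_ext_graph classes_def)
  then obtain w where "w \<in> ?W" "w \<in> K" using joined_to_ext_verts[OF _ ne] verts_non_ext_subset by blast
  then have "K \<inter> ?W \<noteq> {}" by blast
  then show "1 \<le> card (K \<inter> ?W)" using finW by (simp add: Suc_le_eq card_gt_0_iff)
qed

lemma cilia_in_ext_verts: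
  assumes "card (cilia M) \<noteq> 1"
  shows "cilia M \<subseteq> ext_verts D M"
proof
  fix v assume v: "v \<in> cilia M"
  have "cilia M \<noteq> {v}" using assms by auto
  then obtain i w where w: "i \<in> {1..D}" "w \<in> cilia M" "w \<noteq> v" "(v, w) \<in> joins i"
    using cilia_joined v by blast
  then have "{v, w} \<subseteq> joins i `` {v} \<inter> cilia M" using v by simp
  then have "card {v, w} \<le> card (joins i `` {v} \<inter> cilia M)"
    by (intro card_mono) (simp_all add: finite_cilia)
  then have "joins i `` {v} \<in> ext_components i"
    using w v class_in_components[of v i] cilia_verts by (auto simp: ext_components_def)
  then have "v \<in> verts (ext_forest M i)" by (rule ext_forest_memberI)
  then show "v \<in> ext_verts D M" using w(1) by (auto simp: ext_verts_def)
qed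

section \<open>The excess when the color parts are forests\<close>

lemma excess_forest_several_cilia:
  assumes mono: "monochromatic_forests D M" and several: "card (cilia M) \<noteq> 1"
  shows "0 \<le> excess" "excess = 0 \<longleftrightarrow> ext_forests_share_cilia D M \<and> non_ext_forest D M"
proof -
  let ?N = "non_ext_graph D M" and ?W = "ext_verts D M"
  let ?B = "\<lambda>i. verts (ext_forest M i) - cilia M"
  have CW: "cilia M \<subseteq> ?W" using several by (rule cilia_in_ext_verts)
  then have ne: "?W \<noteq> {}" using cilia_nonempty by blast
  have finU: "finite (verts (ext_forest M i))" for i
    using verts_ext_forest_subset finite_verts by (rule finite_subset)
  have W: "?W - cilia M = (\<Union>i \<in> {1..D}. ?B i)" by (auto simp: ext_verts_def)
  have "V - cilia M = (V - ?W) \<union> (?W - cilia M)" using CW ext_verts_subset by blast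
  moreover have "card ((V - ?W) \<union> (?W - cilia M)) = card (V - ?W) + card (?W - cilia M)"
    using finite_subset[OF ext_verts_subset finite_verts] by (intro card_Un_disjoint) auto
  ultimately have VC: "card (V - cilia M) = card (V - ?W) + card (\<Union>i \<in> {1..D}. ?B i)" using W by metis
  define a where "a = (\<Sum>i = 1..D. int (card (?B i))) - int (card (\<Union>i \<in> {1..D}. ?B i))"
  define s where "s = (\<Sum>K \<in> components ?N. int (card (K \<inter> ?W)) - 1)"
  have excess: "excess = a + circuit_rank ?N + s"
    unfolding excess_forest[OF mono] card_non_ext_arcs(1)[OF ne] VC a_def s_def by simp
  have "card (\<Union>i \<in> {1..D}. ?B i) \<le> (\<Sum>i = 1..D. card (?B i))" by (rule card_UN_le) simp
  then have "int (card (\<Union>i \<in> {1..D}. ?B i)) \<le> int (\<Sum>i = 1..D. card (?B i))" by (rule of_nat_mono)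
  then have a0: "0 \<le> a" unfolding a_def by simp
  have "a = 0 \<longleftrightarrow> int (card (\<Union>i \<in> {1..D}. ?B i)) = int (\<Sum>i = 1..D. card (?B i))" unfolding a_def by auto
  also have "\<dots> \<longleftrightarrow> (\<forall>i \<in> {1..D}. \<forall>j \<in> {1..D}. i \<noteq> j \<longrightarrow> ?B i \<inter> ?B j = {})"
    unfolding of_nat_eq_iff by (rule card_UN_eq_sum_iff) (simp_all add: finU)
  also have "\<dots> \<longleftrightarrow> ext_forests_share_cilia D M" unfolding ext_forests_share_cilia_def by blast
  finally have a_iff: "a = 0 \<longleftrightarrow> ext_forests_share_cilia D M" .
  have fink: "finite (components ?N)"
    using finite_subset[OF verts_non_ext_subset finite_verts] by (simp add: components_non_ext_graph)
  have term0: "0 \<le> int (card (K \<inter> ?W)) - 1" if "K \<in> components ?N" for K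
    using card_non_ext_arcs(2)[OF ne that] by simp
  have s0: "0 \<le> s" unfolding s_def by (rule sum_nonneg) (rule term0)
  have "s = 0 \<longleftrightarrow> (\<forall>K \<in> components ?N. int (card (K \<inter> ?W)) - 1 = 0)"
    unfolding s_def by (rule sum_nonneg_eq_0_iff[OF fink term0])
  also have "\<dots> \<longleftrightarrow> (\<forall>K \<in> components ?N. card (K \<inter> ?W) = 1)" by auto
  finally have s_iff: "s = 0 \<longleftrightarrow> (\<forall>K \<in> components ?N. card (K \<inter> ?W) = 1)" .
  have l0: "0 \<le> circuit_rank ?N" by (rule circuit_rank_nonneg[OF fin_non_ext_graph])
  have "non_ext_forest D M \<longleftrightarrow> circuit_rank ?N = 0 \<and> s = 0"
    using ne by (simp add: non_ext_forest_def s_iff undirected_forest_iff_circuit_rank[OF fin_non_ext_graph])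
  moreover have "excess = 0 \<longleftrightarrow> a = 0 \<and> circuit_rank ?N = 0 \<and> s = 0"
    unfolding excess using a0 s0 l0 by linarith
  ultimately show "excess = 0 \<longleftrightarrow> ext_forests_share_cilia D M \<and> non_ext_forest D M"
    using a_iff by blast
  show "0 \<le> excess" unfolding excess using a0 s0 l0 by simp
qed

text \<open>There are no external trees, so all edges are non-external and the excess is the circuit
  rank of the whole map.\<close>

lemma excess_forest_one_cilium:
  assumes mono: "monochromatic_forests D M" and one: "card (cilia M) = 1"
  shows "0 \<le> excess" "excess = 0 \<longleftrightarrow> ext_forests_share_cilia D M \<and> non_ext_forest D M"
proof -
  let ?N = "non_ext_graph D M"
  have "\<not> 2 \<le> card (K \<inter> cilia M)" for K
    using card_mono[OF finite_cilia, of "K \<inter> cilia M"] one by simp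
  then have U: "verts (ext_forest M i) = {}" for i
    unfolding verts_ext_forest ext_components_def by simp
  then have W: "ext_verts D M = {}" by (simp add: ext_verts_def)
  have arcs: "arcs ?N = arcs (mgraph M)" by (simp add: arcs_non_ext_graph arcs_ext_forest U)
  have "card (V - cilia M) = card V - 1"
    using card_Diff_subset[OF finite_cilia cilia_verts] one by simp
  moreover have "1 \<le> card V" using card_mono[OF finite_verts cilia_verts] one by simp
  ultimately have "excess = int (card (arcs (mgraph M))) - int (card V) + 1"
    unfolding excess_forest[OF mono] arcs by (simp add: U)
  moreover have "card (components (mgraph M)) = 1"
  proof -
    obtain c where c: "c \<in> cilia M" using cilia_nonempty by blast
    then have "card (classes V (arcs_ends (mgraph M))) = 1"
      using conn cilia_verts by (intro card_classes_eq_1[of c]) (auto simp: connected_iff)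
    then show ?thesis by (simp add: components_eq)
  qed
  ultimately have excess: "excess = circuit_rank (mgraph M)" by (simp add: circuit_rank_def)
  show "0 \<le> excess" unfolding excess by (rule circuit_rank_nonneg[OF fin])
  \<comment> \<open>The two graphs have the same edges, but \<open>?N\<close> has no vertex if the
    map is a single isolated vertex.\<close>
  have "undirected_forest ?N \<longleftrightarrow> undirected_forest (mgraph M)"
    using undirected_forest_subgraph[OF wf_digraph_of_fin[OF fin_non_ext_graph] wf_digraph_of_fin[OF fin]]
      undirected_forest_subgraph[OF wf_digraph_of_fin[OF fin] wf_digraph_of_fin[OF fin_non_ext_graph]] arcs by auto
  then show "excess = 0 \<longleftrightarrow> ext_forests_share_cilia D M \<and> non_ext_forest D M"
    unfolding excess by (simp add: ext_forests_share_cilia_def non_ext_forest_def U W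
        undirected_forest_iff_circuit_rank[OF fin])
qed

lemma excess_nonneg_forest: "monochromatic_forests D M \<Longrightarrow> 0 \<le> excess"
  using excess_forest_several_cilia(1) excess_forest_one_cilium(1) by blast

lemma excess_eq_0_iff_forest:
  "monochromatic_forests D M \<Longrightarrow> excess = 0 \<longleftrightarrow> ext_forests_share_cilia D M \<and> non_ext_forest D M"
  using excess_forest_several_cilia(2) excess_forest_one_cilium(2) by blast

end

text \<open>Removing an edge of a monochromatic cycle changes no component of any color, so it
  preserves both the excess and the locale assumptions. Repeating this leads to monochromatic
  forests.\<close>

lemma ciliated_graph_excess_nonneg:
  assumes "ciliated_graph D M"
  shows "0 \<le> ciliated_graph.excess D M"
  using assms
proof (induction "card (arcs (mgraph M))" arbitrary: M rule: less_induct)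
  case (less M)
  interpret ciliated_graph D M by (rule less.prems)
  show ?case
  proof (cases "monochromatic_forests D M")
    case True
    then show ?thesis by (rule excess_nonneg_forest)
  next
    case False
    then obtain i e where e: "e \<in> arcs (mgraph M)" "color M e = i"
      and cyc: "(tail (mgraph M) e, head (mgraph M) e) \<in>
        eqcl (arcs_ends ((color_part M i)\<lparr>arcs := arcs (color_part M i) - {e}\<rparr>))"
      by (auto simp: monochromatic_forests_def undirected_forest_iff[OF wf_digraph_of_fin[OF fin_color]])
    define M' where "M' = M\<lparr>mgraph := (mgraph M)\<lparr>arcs := arcs (mgraph M) - {e}\<rparr>\<rparr>"
    have M'_simps: "verts (mgraph M') = V" "arcs (mgraph M') = arcs (mgraph M) - {e}"
      "tail (mgraph M') = tail (mgraph M)" "head (mgraph M') = head (mgraph M)"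
      "color M' = color M" "cilia M' = cilia M"
      by (simp_all add: M'_def)
    have ends_i: "arcs_ends (color_part M' i) = arcs_ends ((color_part M i)\<lparr>arcs := arcs (color_part M i) - {e}\<rparr>)"
      unfolding arcs_ends_eq by (rule image_cong) (auto simp: M'_simps)
    have "arcs_ends (color_part M i) = insert (tail (mgraph M) e, head (mgraph M) e) (arcs_ends (color_part M' i))"
      using e by (auto simp: arcs_ends_eq M'_simps)
    then have "eqcl (arcs_ends (color_part M i)) = eqcl (arcs_ends (color_part M' i))"
      using eqcl_insert_redundant[of "tail (mgraph M) e" "head (mgraph M) e"] cyc ends_i by simp
    moreover have "arcs_ends (color_part M' j) = arcs_ends (color_part M j)" if "j \<noteq> i" for j
      unfolding arcs_ends_eq by (rule image_cong) (use that e in \<open>auto simp: M'_simps\<close>)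
    ultimately have joins': "eqcl (arcs_ends (color_part M' j)) = joins j" for j
      by (cases "j = i") simp_all
    have "arcs_ends (color_part M' i) \<subseteq> arcs_ends (mgraph M')" by (auto simp: arcs_ends_eq M'_simps)
    then have "(tail (mgraph M) e, head (mgraph M) e) \<in> eqcl (arcs_ends (mgraph M'))"
      using cyc ends_i eqcl_mono by metis
    moreover have "arcs_ends (mgraph M) = insert (tail (mgraph M) e, head (mgraph M) e) (arcs_ends (mgraph M'))"
      using e by (auto simp: arcs_ends_eq M'_simps)
    ultimately have all: "eqcl (arcs_ends (mgraph M')) = eqcl (arcs_ends (mgraph M))"
      using eqcl_insert_redundant[of "tail (mgraph M) e" "head (mgraph M) e"] by simp
    have fin': "fin_digraph (mgraph M')"
      unfolding M'_def using fin_digraph_update_arcs[OF fin, of "arcs (mgraph M) - {e}"] by simp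
    have M': "ciliated_graph D M'"
    proof (rule ciliated_graph.intro)
      show "connected (mgraph M')"
        using conn unfolding connected_iff wf_digraph.connected_iff[OF wf_digraph_of_fin[OF fin']] all
        by (simp add: M'_simps)
      show "\<exists>i \<in> {1..D}. \<exists>w \<in> cilia M'. w \<noteq> v \<and> (v, w) \<in> eqcl (arcs_ends (color_part M' i))"
        if "v \<in> cilia M'" "cilia M' \<noteq> {v}" for v
        using cilia_joined that unfolding joins' M'_simps by blast
    qed (use fin' colors cilia_verts cilia_nonempty in \<open>auto simp: M'_simps\<close>)
    have comps: "components (color_part M' j) = components (color_part M j)" for j
      using ciliated_graph.components_color[OF M', of j] components_color[of j]
      by (simp add: classes_def joins' M'_simps)
    have "card (arcs (mgraph M')) < card (arcs (mgraph M))"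
      unfolding M'_simps using e by (intro psubset_card_mono) auto
    from less.hyps[OF this M'] have "0 \<le> ciliated_graph.excess D M'" .
    also have "ciliated_graph.excess D M' = excess"
      unfolding excess_def ciliated_graph.excess_def[OF M'] ciliated_components_def comps M'_simps ..
    finally show ?thesis .
  qed
qed

section \<open>The bound on the power\<close>

lemma ciliated_graph_of_map:
  assumes M: "edge_colored_map D M" and bubble: "bubble D (boundary_graph D M)"
  shows "ciliated_graph D M"
proof (rule ciliated_graph.intro)
  show "cilia M \<noteq> {}" by (rule boundary_bubble(1)[OF assms])
  show "\<exists>i \<in> {1..D}. \<exists>w \<in> cilia M. w \<noteq> v \<and> (v, w) \<in> eqcl (arcs_ends (color_part M i))"
    if "v \<in> cilia M" "cilia M \<noteq> {v}" for v
    using cilium_joined_to_other[OF assms that] .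
qed (use M in \<open>auto simp: edge_colored_map_def\<close>)

lemma card_arcs_by_color:
  assumes "edge_colored_map D M"
  shows "card (arcs (mgraph M)) = (\<Sum>i = 1..D. card (arcs (color_part M i)))"
proof -
  have fin: "finite (arcs (color_part M i))" for i
    using assms by (intro fin_digraph.finite_arcs fin_digraph_color_part) (simp add: edge_colored_map_def)
  have "arcs (mgraph M) = (\<Union>i \<in> {1..D}. arcs (color_part M i))"
    using assms by (auto simp: edge_colored_map_def)
  also have "card \<dots> = (\<Sum>i = 1..D. card (arcs (color_part M i)))"
    using fin by (intro card_UN_disjoint) auto
  finally show ?thesis .
qed

text \<open>The converse starts at \<open>D = 3\<close>: for \<open>D = 2\<close>, one ciliated
  vertex with a single loop attains the bound although its color part is not a forest.\<close>

theorem theorem6: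
  fixes M :: "('v, 'e) colored_map" and D p :: nat
  assumes "2 \<le> D"
    and "edge_colored_map D M"
    and "card (cilia M) = p"
    and "bubble D (boundary_graph D M)"
  shows "let bound = - (int D - 1) *
               (int p + optimality D (boundary_graph D M) (induced_pairing M) - 1);
             conditions =
               (monochromatic_forests D M \<and> ext_forests_share_cilia D M \<and> non_ext_forest D M)
         in map_power D M \<le> bound \<and>
            (conditions \<longrightarrow> map_power D M = bound) \<and>
            (3 \<le> D \<longrightarrow> (map_power D M = bound \<longleftrightarrow> conditions))"
proof -
  note M = assms(2) and bubble = assms(4)
  interpret G: ciliated_graph D M using M bubble by (rule ciliated_graph_of_map)
  define F b k c l where "F i = int (num_closed_faces M i)" and "b i = int (boundary_cycles M i)"
    and "k i = int (card (components (color_part M i)))" and "c i = int (card (ciliated_components M i))"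
    and "l i = circuit_rank (color_part M i)" for i
  define bound where "bound = - (int D - 1) * (int p + optimality D (boundary_graph D M) (induced_pairing M) - 1)"
  let ?V = "int (card G.V)"
  have Fb: "F i + b i \<le> k i + l i" and cb: "c i \<le> b i" and kF: "k i \<le> F i + c i" and l0: "0 \<le> l i" for i
    using color_inequalities[OF M, of i] circuit_rank_nonneg[OF G.fin_color[of i]]
    unfolding F_def b_def k_def c_def l_def by simp_all
  have E: "int (card (arcs (mgraph M))) = (\<Sum>i = 1..D. ?V - k i + l i)"
    unfolding card_arcs_by_color[OF M] l_def k_def circuit_rank_def by simp
  have excess: "G.excess = (int D - 1) * (?V - int p) - (\<Sum>i = 1..D. k i - c i)"
    unfolding G.excess_def k_def c_def assms(3) ..
  have X0: "0 \<le> G.excess" by (rule ciliated_graph_excess_nonneg[OF G.ciliated_graph_axioms])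
  define S1 S2 S3 where "S1 = (\<Sum>i = 1..D. b i - c i)" and "S2 = (\<Sum>i = 1..D. l i)"
    and "S3 = (\<Sum>i = 1..D. k i + l i - F i - b i)"
  have S0: "0 \<le> S1" "0 \<le> S2" "0 \<le> S3" unfolding S1_def S2_def S3_def
    using cb l0 Fb by (auto intro!: sum_nonneg simp: algebra_simps)
  \<comment> \<open>The \<open>c i\<close> cancel between \<open>G.excess\<close> and
    \<open>S1\<close>; they are inserted to make each of the two terms nonnegative.\<close>
  have deficit: "bound - map_power D M = int D * G.excess + int D * S1 + (int D - 2) * S2 + S3"
  proof -
    have "map_power D M = (\<Sum>i = 1..D. F i) - (int D - 1) * (\<Sum>i = 1..D. ?V - k i + l i)"
      unfolding map_power_def E F_def by simp
    moreover have "bound = - (int D - 1) * (int D * int p - (\<Sum>i = 1..D. b i))"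
      unfolding bound_def optimality_eq[OF M bubble] assms(3) b_def by (simp add: algebra_simps)
    ultimately show ?thesis
      unfolding excess S1_def S2_def S3_def by (simp add: sum.distrib sum_subtractf algebra_simps)
  qed
  have D: "0 \<le> int D - 2" "0 < int D" using assms(1) by simp_all
  have nonneg: "0 \<le> int D * G.excess" "0 \<le> int D * S1" "0 \<le> (int D - 2) * S2"
    using X0 S0 D by simp_all
  have "map_power D M \<le> bound" using deficit nonneg S0 by linarith
  moreover have mono_iff: "monochromatic_forests D M \<longleftrightarrow> (\<forall>i \<in> {1..D}. l i = 0)"
    unfolding monochromatic_forests_def l_def undirected_forest_iff_circuit_rank[OF G.fin_color] ..
  moreover have "map_power D M = bound"
    if cond: "monochromatic_forests D M" "ext_forests_share_cilia D M" "non_ext_forest D M"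
  proof -
    have "G.excess = 0" using G.excess_eq_0_iff_forest cond by blast
    \<comment> \<open>With \<open>l i = 0\<close> the inequalities close up to
      \<open>F i + b i \<le> k i \<le> F i + c i \<le> F i + b i\<close>, so all are
      equalities.\<close>
    moreover have z: "b i - c i = 0" "l i = 0" "k i + l i - F i - b i = 0" if "i \<in> {1..D}" for i
      using mono_iff cond(1) that Fb[of i] cb[of i] kF[of i] by auto
    have "S1 = 0" "S2 = 0" "S3 = 0"
      unfolding S1_def S2_def S3_def by (rule sum.neutral, intro ballI, rule z, assumption)+
    ultimately show ?thesis using deficit by simp
  qed
  moreover have "monochromatic_forests D M \<and> ext_forests_share_cilia D M \<and> non_ext_forest D M"
    if eq: "map_power D M = bound" and D3: "3 \<le> D"
  proof -
    \<comment> \<open>A vanishing sum of nonnegative terms vanishes termwise; the factor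
      \<open>int D - 2\<close> can then be cancelled as it is positive.\<close>
    have "int D * G.excess = 0" "(int D - 2) * S2 = 0" using deficit nonneg S0 eq by linarith+
    then have "G.excess = 0" "S2 = 0" using D3 by auto
    then have "\<forall>i \<in> {1..D}. l i = 0" unfolding S2_def using l0 by (simp add: sum_nonneg_eq_0_iff)
    then have "monochromatic_forests D M" using mono_iff by blast
    then show ?thesis using G.excess_eq_0_iff_forest \<open>G.excess = 0\<close> by blast
  qed
  ultimately show ?thesis unfolding Let_def bound_def[symmetric] by blast
qed

end
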